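(* Let $\mathcal A=\langle A,T,Q,\gamma,\eta,\varepsilon\rangle$ be a skew monoidal monoid. Define - $G:=\mathcal A^T(\mu,\mu)=\mu T(A)$, a submonoid of $A$; - source $s^G:A\to G$, $s^G(a):=T(a)$; - target $t^G:A^{\mathrm{op}}\to G$, $t^G(a):=S(a)$; - comultiplication $\Delta^G:G\to G\otimes_A G$, $\Delta^G(g):=\mu\otimes_A\mu T(\delta g\eta)$; - counit $\epsilon^G:G\to A$, $\epsilon^G(g):=\varepsilon g\eta$. Then $G$ is a right $A$-bialgebroid, and the functor $\mathcal A^T(\mu,-):\mathcal A^T\to{}_A\mathbf{Set}_A$, $x\mapsto xT(A)$ (with $a_1\cdot t\cdot a_2:=tS(a_1)T(a_2)$), factorizes through the forgetful functor $\mathbf{Set}_G\to{}_A\mathbf{Set}_A$ of the right bialgebroid $G$ via a fully faithful functor $\mathcal A^T\to\mathbf{Set}_G$ (where $G$ acts on $\mathcal A^T(\mu,x)=xT(A)$ by right multiplication).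
   Context: A skew monoidal monoid $\mathcal A=\langle A,T,Q,\gamma,\eta,\varepsilon\rangle$ consists of a monoid $A$, monoid endomorphisms $T,Q:A\to A$ and elements $\gamma,\eta,\varepsilon\in A$ such that for all $a,b\in A$: $T(a)Q(b)=Q(b)T(a)$, $\gamma T^2(a)=T(a)\gamma$, $\gamma TQ(a)=QT(a)\gamma$, $\gamma Q(a)=Q^2(a)\gamma$, $\eta a=T(a)\eta$, $a\varepsilon=\varepsilon Q(a)$, $Q(\gamma)\gamma T(\gamma)=\gamma^2$, $\gamma\eta=Q(\eta)$, $\varepsilon\gamma=T(\varepsilon)$, $Q(\varepsilon)\gamma T(\eta)=1$, $\varepsilon\eta=1$. Put $\mu:=Q(\varepsilon)\gamma$, $\delta:=\gamma T(\eta)$ (then $\gamma=\mu\delta$) and $S:A\to A^{\mathrm{op}}$, $S(a):=\mu T(Q(a)\eta)$, a monoid morphism. The module category $\mathcal A^T$ has as objects the elements $x\in A$ with $x\mu=xT(x)$ and $x\eta=1$; its arrows $t:x\to y$ are the elements $t\in A$ with $tx=yT(t)$; composition is multiplication in $A$. One has $\mathcal A^T(\mu,x)=xT(A)$. ${}_A\mathbf{Set}_A$ is the monoidal category of $A$-$A$-bisets (bimodules) with tensor product $\otimes_A$ and unit $A$. $\mathbf{Set}_G$ is the category of right $G$-sets. A right $A$-bialgebroid (over a monoid $A$, in sets) is a monoid $G$ with monoid morphisms $s:A\to G$, $t:A^{\mathrm{op}}\to G$ whose images commute, together with a comonoid structure $\Delta:G\to G\otimes_AG$, $g\mapsto g^{(1)}\otimes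 g^{(2)}$, $\epsilon:G\to A$ in ${}_A\mathbf{Set}_A$, where $G$ is a bimodule by $a_1\cdot g\cdot a_2=g\,t(a_1)s(a_2)$, such that for all $a\in A$, $g,h\in G$: $s(a)g^{(1)}\otimes g^{(2)}=g^{(1)}\otimes t(a)g^{(2)}$, $\Delta(gh)=g^{(1)}h^{(1)}\otimes g^{(2)}h^{(2)}$, $\Delta(1)=1\otimes1$, $\epsilon(1)=1$, $\epsilon(s(\epsilon(g))h)=\epsilon(gh)=\epsilon(t(\epsilon(g))h)$. The forgetful functor $\mathbf{Set}_G\to{}_A\mathbf{Set}_A$ sends $M$ to $M$ with $a_1\cdot m\cdot a_2=m\,t(a_1)s(a_2)$. *)

theory Defs
  imports "HOL-Algebra.Group"
begin

section \<open>Categories and functors\<close>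

text \<open>
  Hom-sets are indexed by their endpoints and need not be disjoint, so one element may serve as
  an arrow between several pairs of objects; composition and identities take the objects as
  arguments. \<open>cmp C x y z g f\<close> is the composite of \<open>f : x \<rightarrow> y\<close> followed by \<open>g : y \<rightarrow> z\<close>.
\<close>

record ('o, 'm) cat =
  obj :: "'o set"
  mor :: "'o \<Rightarrow> 'o \<Rightarrow> 'm set"
  idt :: "'o \<Rightarrow> 'm"
  cmp :: "'o \<Rightarrow> 'o \<Rightarrow> 'o \<Rightarrow> 'm \<Rightarrow> 'm \<Rightarrow> 'm"

locale is_category =
  fixes C :: "('o, 'm) cat"
  assumes idt_closed: "x \<in> obj C \<Longrightarrow> idt C x \<in> mor C x x"
    and cmp_closed: "\<lbrakk>x \<in> obj C; y \<in> obj C; z \<in> obj C; f \<in> mor C x y; g \<in> mor C y z\<rbrakk>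
      \<Longrightarrow> cmp C x y z g f \<in> mor C x z"
    and idt_left: "\<lbrakk>x \<in> obj C; y \<in> obj C; f \<in> mor C x y\<rbrakk> \<Longrightarrow> cmp C x y y (idt C y) f = f"
    and idt_right: "\<lbrakk>x \<in> obj C; y \<in> obj C; f \<in> mor C x y\<rbrakk> \<Longrightarrow> cmp C x x y f (idt C x) = f"
    and cmp_assoc: "\<lbrakk>w \<in> obj C; x \<in> obj C; y \<in> obj C; z \<in> obj C;
      f \<in> mor C w x; g \<in> mor C x y; h \<in> mor C y z\<rbrakk>
      \<Longrightarrow> cmp C w x z (cmp C x y z h g) f = cmp C w y z h (cmp C w x y g f)"

record ('o1, 'm1, 'o2, 'm2) func =
  on_obj :: "'o1 \<Rightarrow> 'o2"
  on_mor :: "'o1 \<Rightarrow> 'o1 \<Rightarrow> 'm1 \<Rightarrow> 'm2"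

locale is_functor = C: is_category C + D: is_category D
  for C :: "('o1, 'm1) cat" and D :: "('o2, 'm2) cat" +
  fixes F :: "('o1, 'm1, 'o2, 'm2) func"
  assumes on_obj_closed: "x \<in> obj C \<Longrightarrow> on_obj F x \<in> obj D"
    and on_mor_closed: "\<lbrakk>x \<in> obj C; y \<in> obj C; f \<in> mor C x y\<rbrakk>
      \<Longrightarrow> on_mor F x y f \<in> mor D (on_obj F x) (on_obj F y)"
    and on_mor_idt: "x \<in> obj C \<Longrightarrow> on_mor F x x (idt C x) = idt D (on_obj F x)"
    and on_mor_cmp: "\<lbrakk>x \<in> obj C; y \<in> obj C; z \<in> obj C; f \<in> mor C x y; g \<in> mor C y z\<rbrakk>
      \<Longrightarrow> on_mor F x z (cmp C x y z g f)
        = cmp D (on_obj F x) (on_obj F y) (on_obj F z) (on_mor F y z g) (on_mor F x y f)"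

definition fully_faithful ::
  "('o1, 'm1) cat \<Rightarrow> ('o2, 'm2) cat \<Rightarrow> ('o1, 'm1, 'o2, 'm2) func \<Rightarrow> bool" where
  "fully_faithful C D F \<longleftrightarrow>
    (\<forall>x\<in>obj C. \<forall>y\<in>obj C. bij_betw (on_mor F x y) (mor C x y) (mor D (on_obj F x) (on_obj F y)))"

definition func_comp :: "('o2, 'm2, 'o3, 'm3) func \<Rightarrow> ('o1, 'm1, 'o2, 'm2) func
    \<Rightarrow> ('o1, 'm1, 'o3, 'm3) func" where
  "func_comp U F = \<lparr>on_obj = (\<lambda>x. on_obj U (on_obj F x)),
     on_mor = (\<lambda>x y f. on_mor U (on_obj F x) (on_obj F y) (on_mor F x y f))\<rparr>"

definition func_eq :: "('o1, 'm1) cat \<Rightarrow> ('o1, 'm1, 'o2, 'm2) func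
    \<Rightarrow> ('o1, 'm1, 'o2, 'm2) func \<Rightarrow> bool" where
  "func_eq C F H \<longleftrightarrow> (\<forall>x\<in>obj C. on_obj F x = on_obj H x) \<and>
    (\<forall>x\<in>obj C. \<forall>y\<in>obj C. \<forall>f\<in>mor C x y. on_mor F x y f = on_mor H x y f)"


section \<open>Monoid morphisms\<close>

text \<open>\<^const>\<open>hom\<close> does not require preservation of the unit.\<close>

definition monoid_mor :: "('a, 'x) monoid_scheme \<Rightarrow> ('b, 'y) monoid_scheme \<Rightarrow> ('a \<Rightarrow> 'b) set" where
  "monoid_mor M N = {h \<in> hom M N. h \<one>\<^bsub>M\<^esub> = \<one>\<^bsub>N\<^esub>}"

definition opp :: "('a, 'x) monoid_scheme \<Rightarrow> 'a monoid" where
  "opp M = \<lparr>carrier = carrier M, mult = (\<lambda>a b. b \<otimes>\<^bsub>M\<^esub> a), one = \<one>\<^bsub>M\<^esub>\<rparr>"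


section \<open>The monoidal category of bisets\<close>

record ('a, 'm) biset =
  bcar :: "'m set"
  lact :: "'a \<Rightarrow> 'm \<Rightarrow> 'm"
  ract :: "'m \<Rightarrow> 'a \<Rightarrow> 'm"

locale is_biset = monoid A for A (structure) +
  fixes M :: "('a, 'm) biset"
  assumes lact_closed: "\<lbrakk>a \<in> carrier A; m \<in> bcar M\<rbrakk> \<Longrightarrow> lact M a m \<in> bcar M"
    and ract_closed: "\<lbrakk>a \<in> carrier A; m \<in> bcar M\<rbrakk> \<Longrightarrow> ract M m a \<in> bcar M"
    and lact_one: "m \<in> bcar M \<Longrightarrow> lact M \<one> m = m"
    and ract_one: "m \<in> bcar M \<Longrightarrow> ract M m \<one> = m"
    and lact_mult: "\<lbrakk>a \<in> carrier A; b \<in> carrier A; m \<in> bcar M\<rbrakk>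
      \<Longrightarrow> lact M (a \<otimes> b) m = lact M a (lact M b m)"
    and ract_mult: "\<lbrakk>a \<in> carrier A; b \<in> carrier A; m \<in> bcar M\<rbrakk>
      \<Longrightarrow> ract M m (a \<otimes> b) = ract M (ract M m a) b"
    and lact_ract: "\<lbrakk>a \<in> carrier A; b \<in> carrier A; m \<in> bcar M\<rbrakk>
      \<Longrightarrow> ract M (lact M a m) b = lact M a (ract M m b)"

text \<open>Maps are extensional functions, so that equality of arrows is equality of maps.\<close>

definition biset_hom ::
  "('a, 'x) monoid_scheme \<Rightarrow> ('a, 'm) biset \<Rightarrow> ('a, 'n) biset \<Rightarrow> ('m \<Rightarrow> 'n) set" where
  "biset_hom A M N = {f \<in> bcar M \<rightarrow>\<^sub>E bcar N. \<forall>a\<in>carrier A. \<forall>m\<in>bcar M.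
     f (lact M a m) = lact N a (f m) \<and> f (ract M m a) = ract N (f m) a}"

text \<open>The \<open>A\<close>-\<open>A\<close>-bisets with carrier in the type \<open>'m\<close>.\<close>

definition biset_cat :: "('a, 'x) monoid_scheme \<Rightarrow> (('a, 'm) biset, 'm \<Rightarrow> 'm) cat" where
  "biset_cat A = \<lparr>obj = {M. is_biset A M}, mor = biset_hom A,
     idt = (\<lambda>M. \<lambda>m\<in>bcar M. m), cmp = (\<lambda>M N P g f. compose (bcar M) g f)\<rparr>"

text \<open>
  The equivalence relation on \<open>M \<times> N\<close> generated by \<open>(m \<cdot> a, n) \<sim> (m, a \<cdot> n)\<close>; its classes are
  the elements of the tensor product of \<open>M\<close> and \<open>N\<close> over \<open>A\<close>.
\<close>

definition tensor_gen :: "('a, 'x) monoid_scheme \<Rightarrow> ('a, 'm) biset \<Rightarrow> ('a, 'n) biset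
    \<Rightarrow> ('m \<times> 'n) \<Rightarrow> ('m \<times> 'n) \<Rightarrow> bool" where
  "tensor_gen A M N p q \<longleftrightarrow> (\<exists>m\<in>bcar M. \<exists>n\<in>bcar N. \<exists>a\<in>carrier A.
     p = (ract M m a, n) \<and> q = (m, lact N a n))"

definition tensor_rel :: "('a, 'x) monoid_scheme \<Rightarrow> ('a, 'm) biset \<Rightarrow> ('a, 'n) biset
    \<Rightarrow> (('m \<times> 'n) \<times> ('m \<times> 'n)) set" where
  "tensor_rel A M N = {(p, q). p \<in> bcar M \<times> bcar N \<and> q \<in> bcar M \<times> bcar N \<and>
     equivclp (tensor_gen A M N) p q}"

definition tens :: "('a, 'x) monoid_scheme \<Rightarrow> ('a, 'm) biset \<Rightarrow> ('a, 'n) biset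
    \<Rightarrow> 'm \<Rightarrow> 'n \<Rightarrow> ('m \<times> 'n) set" where
  "tens A M N m n = tensor_rel A M N `` {(m, n)}"

text \<open>
  Maps out of a tensor product are given on representatives: the images of the representatives
  of a class are saturated under the target relation. If the map respects the relations, as it
  does in all cases below, the result is a single class.
\<close>

definition tensor :: "('a, 'x) monoid_scheme \<Rightarrow> ('a, 'm) biset \<Rightarrow> ('a, 'n) biset
    \<Rightarrow> ('a, ('m \<times> 'n) set) biset" where
  "tensor A M N = \<lparr>bcar = (bcar M \<times> bcar N) // tensor_rel A M N,
     lact = (\<lambda>a X. \<Union>(m, n)\<in>X. tens A M N (lact M a m) n),
     ract = (\<lambda>X a. \<Union>(m, n)\<in>X. tens A M N m (ract N n a))\<rparr>"

definition tensor_map :: "('a, 'x) monoid_scheme \<Rightarrow> ('a, 'm) biset \<Rightarrow> ('a, 'n) biset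
    \<Rightarrow> ('a, 'm1) biset \<Rightarrow> ('a, 'n1) biset \<Rightarrow> ('m \<Rightarrow> 'm1) \<Rightarrow> ('n \<Rightarrow> 'n1)
    \<Rightarrow> ('m \<times> 'n) set \<Rightarrow> ('m1 \<times> 'n1) set" where
  "tensor_map A M N M1 N1 f g =
     (\<lambda>X\<in>bcar (tensor A M N). \<Union>(m, n)\<in>X. tens A M1 N1 (f m) (g n))"

definition tensor_unit :: "('a, 'x) monoid_scheme \<Rightarrow> ('a, 'a) biset" where
  "tensor_unit A = \<lparr>bcar = carrier A, lact = mult A, ract = mult A\<rparr>"

definition tensor_assoc :: "('a, 'x) monoid_scheme \<Rightarrow> ('a, 'm) biset \<Rightarrow> ('a, 'n) biset
    \<Rightarrow> ('a, 'p) biset \<Rightarrow> (('m \<times> 'n) set \<times> 'p) set \<Rightarrow> ('m \<times> ('n \<times> 'p) set) set" where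
  "tensor_assoc A M N P = (\<lambda>X\<in>bcar (tensor A (tensor A M N) P).
     \<Union>(Y, p)\<in>X. \<Union>(m, n)\<in>Y. tens A M (tensor A N P) m (tens A N P n p))"

definition tensor_lunit ::
  "('a, 'x) monoid_scheme \<Rightarrow> ('a, 'm) biset \<Rightarrow> ('a \<times> 'm) set \<Rightarrow> 'm" where
  "tensor_lunit A M = (\<lambda>X\<in>bcar (tensor A (tensor_unit A) M).
     the_elem ((\<lambda>(a, m). lact M a m) ` X))"

definition tensor_runit ::
  "('a, 'x) monoid_scheme \<Rightarrow> ('a, 'm) biset \<Rightarrow> ('m \<times> 'a) set \<Rightarrow> 'm" where
  "tensor_runit A M = (\<lambda>X\<in>bcar (tensor A M (tensor_unit A)).
     the_elem ((\<lambda>(m, a). ract M m a) ` X))"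

locale biset_comonoid = is_biset A C for A (structure) and C :: "('a, 'm) biset" +
  fixes \<Delta> :: "'m \<Rightarrow> ('m \<times> 'm) set" and eps :: "'m \<Rightarrow> 'a"
  assumes comult_hom: "\<Delta> \<in> biset_hom A C (tensor A C C)"
    and counit_hom: "eps \<in> biset_hom A C (tensor_unit A)"
    and coassoc: "c \<in> bcar C \<Longrightarrow>
      tensor_assoc A C C C (tensor_map A C C (tensor A C C) C \<Delta> (\<lambda>x\<in>bcar C. x) (\<Delta> c))
      = tensor_map A C C C (tensor A C C) (\<lambda>x\<in>bcar C. x) \<Delta> (\<Delta> c)"
    and counit_left: "c \<in> bcar C \<Longrightarrow>
      tensor_lunit A C (tensor_map A C C (tensor_unit A) C eps (\<lambda>x\<in>bcar C. x) (\<Delta> c)) = c"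
    and counit_right: "c \<in> bcar C \<Longrightarrow>
      tensor_runit A C (tensor_map A C C C (tensor_unit A) (\<lambda>x\<in>bcar C. x) eps (\<Delta> c)) = c"


section \<open>Right bialgebroids\<close>

definition bialgebroid_biset :: "('g, 'y) monoid_scheme \<Rightarrow> ('a \<Rightarrow> 'g) \<Rightarrow> ('a \<Rightarrow> 'g)
    \<Rightarrow> ('a, 'g) biset" where
  "bialgebroid_biset G s t = \<lparr>bcar = carrier G,
     lact = (\<lambda>a g. g \<otimes>\<^bsub>G\<^esub> t a), ract = (\<lambda>g a. g \<otimes>\<^bsub>G\<^esub> s a)\<rparr>"

text \<open>
  Sweedler notation: in \<open>takeuchi\<close> and \<open>comult_mult\<close> the pairs \<open>(g1, g2)\<close>, \<open>(h1, h2)\<close> range over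
  all representatives of the classes \<open>\<Delta> g\<close>, \<open>\<Delta> h\<close>. Both sides of \<open>takeuchi\<close> are independent of
  the representative, and \<open>takeuchi\<close> makes the right-hand side of \<open>comult_mult\<close> independent too.
\<close>

locale right_bialgebroid =
  A: monoid A + G: monoid G
  for A :: "('a, 'x) monoid_scheme" and G :: "('g, 'y) monoid_scheme" +
  fixes s t :: "'a \<Rightarrow> 'g" and \<Delta> :: "'g \<Rightarrow> ('g \<times> 'g) set" and eps :: "'g \<Rightarrow> 'a"
  assumes source: "s \<in> monoid_mor A G"
    and target: "t \<in> monoid_mor (opp A) G"
    and source_target: "\<lbrakk>a \<in> carrier A; b \<in> carrier A\<rbrakk> \<Longrightarrow> s a \<otimes>\<^bsub>G\<^esub> t b = t b \<otimes>\<^bsub>G\<^esub> s a"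
    and comonoid: "biset_comonoid A (bialgebroid_biset G s t) \<Delta> eps"
    and takeuchi: "\<lbrakk>a \<in> carrier A; g \<in> carrier G; (g1, g2) \<in> \<Delta> g\<rbrakk> \<Longrightarrow>
      tens A (bialgebroid_biset G s t) (bialgebroid_biset G s t) (s a \<otimes>\<^bsub>G\<^esub> g1) g2
      = tens A (bialgebroid_biset G s t) (bialgebroid_biset G s t) g1 (t a \<otimes>\<^bsub>G\<^esub> g2)"
    and comult_mult: "\<lbrakk>g \<in> carrier G; h \<in> carrier G; (g1, g2) \<in> \<Delta> g; (h1, h2) \<in> \<Delta> h\<rbrakk> \<Longrightarrow>
      \<Delta> (g \<otimes>\<^bsub>G\<^esub> h) = tens A (bialgebroid_biset G s t) (bialgebroid_biset G s t)
        (g1 \<otimes>\<^bsub>G\<^esub> h1) (g2 \<otimes>\<^bsub>G\<^esub> h2)"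
    and comult_one: "\<Delta> \<one>\<^bsub>G\<^esub>
      = tens A (bialgebroid_biset G s t) (bialgebroid_biset G s t) \<one>\<^bsub>G\<^esub> \<one>\<^bsub>G\<^esub>"
    and counit_one: "eps \<one>\<^bsub>G\<^esub> = \<one>\<^bsub>A\<^esub>"
    and counit_source: "\<lbrakk>g \<in> carrier G; h \<in> carrier G\<rbrakk>
      \<Longrightarrow> eps (s (eps g) \<otimes>\<^bsub>G\<^esub> h) = eps (g \<otimes>\<^bsub>G\<^esub> h)"
    and counit_target: "\<lbrakk>g \<in> carrier G; h \<in> carrier G\<rbrakk>
      \<Longrightarrow> eps (g \<otimes>\<^bsub>G\<^esub> h) = eps (t (eps g) \<otimes>\<^bsub>G\<^esub> h)"

record ('g, 'm) gset =
  gcar :: "'m set"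
  gact :: "'m \<Rightarrow> 'g \<Rightarrow> 'm"

locale is_right_gset = monoid G for G (structure) +
  fixes M :: "('g, 'm) gset"
  assumes gact_closed: "\<lbrakk>m \<in> gcar M; g \<in> carrier G\<rbrakk> \<Longrightarrow> gact M m g \<in> gcar M"
    and gact_one: "m \<in> gcar M \<Longrightarrow> gact M m \<one> = m"
    and gact_mult: "\<lbrakk>m \<in> gcar M; g \<in> carrier G; h \<in> carrier G\<rbrakk>
      \<Longrightarrow> gact M m (g \<otimes> h) = gact M (gact M m g) h"

definition gset_hom ::
  "('g, 'y) monoid_scheme \<Rightarrow> ('g, 'm) gset \<Rightarrow> ('g, 'n) gset \<Rightarrow> ('m \<Rightarrow> 'n) set" where
  "gset_hom G M N = {f \<in> gcar M \<rightarrow>\<^sub>E gcar N.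
     \<forall>m\<in>gcar M. \<forall>g\<in>carrier G. f (gact M m g) = gact N (f m) g}"

text \<open>The right \<open>G\<close>-sets with carrier in the type \<open>'m\<close>.\<close>

definition gset_cat :: "('g, 'y) monoid_scheme \<Rightarrow> (('g, 'm) gset, 'm \<Rightarrow> 'm) cat" where
  "gset_cat G = \<lparr>obj = {M. is_right_gset G M}, mor = gset_hom G,
     idt = (\<lambda>M. \<lambda>m\<in>gcar M. m), cmp = (\<lambda>M N P g f. compose (gcar M) g f)\<rparr>"

definition bialgebroid_forget :: "('a \<Rightarrow> 'g) \<Rightarrow> ('a \<Rightarrow> 'g)
    \<Rightarrow> (('g, 'm) gset, 'm \<Rightarrow> 'm, ('a, 'm) biset, 'm \<Rightarrow> 'm) func" where
  "bialgebroid_forget s t = \<lparr>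
     on_obj = (\<lambda>M. \<lparr>bcar = gcar M, lact = (\<lambda>a m. gact M m (t a)), ract = (\<lambda>m a. gact M m (s a))\<rparr>),
     on_mor = (\<lambda>M N f. f)\<rparr>"


section \<open>Skew monoidal monoids\<close>

record 'a skew_monoid = "'a monoid" +
  T_end :: "'a \<Rightarrow> 'a" (\<open>\<T>\<index>\<close>)
  Q_end :: "'a \<Rightarrow> 'a" (\<open>\<Q>\<index>\<close>)
  gamma :: 'a (\<open>\<gamma>\<index>\<close>)
  eta :: 'a (\<open>\<eta>\<index>\<close>)
  epsilon :: 'a (\<open>\<epsilon>\<index>\<close>)

locale skew_monoidal_monoid = monoid A for A (structure) +
  assumes T_mor: "\<T> \<in> monoid_mor A A"
    and Q_mor: "\<Q> \<in> monoid_mor A A"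
    and gamma_closed: "\<gamma> \<in> carrier A"
    and eta_closed: "\<eta> \<in> carrier A"
    and epsilon_closed: "\<epsilon> \<in> carrier A"
    and T_Q: "\<lbrakk>a \<in> carrier A; b \<in> carrier A\<rbrakk> \<Longrightarrow> \<T> a \<otimes> \<Q> b = \<Q> b \<otimes> \<T> a"
    and gamma_T_T: "a \<in> carrier A \<Longrightarrow> \<gamma> \<otimes> \<T> (\<T> a) = \<T> a \<otimes> \<gamma>"
    and gamma_T_Q: "a \<in> carrier A \<Longrightarrow> \<gamma> \<otimes> \<T> (\<Q> a) = \<Q> (\<T> a) \<otimes> \<gamma>"
    and gamma_Q: "a \<in> carrier A \<Longrightarrow> \<gamma> \<otimes> \<Q> a = \<Q> (\<Q> a) \<otimes> \<gamma>"
    and eta_nat: "a \<in> carrier A \<Longrightarrow> \<eta> \<otimes> a = \<T> a \<otimes> \<eta>"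
    and epsilon_nat: "a \<in> carrier A \<Longrightarrow> a \<otimes> \<epsilon> = \<epsilon> \<otimes> \<Q> a"
    and pentagon: "\<Q> \<gamma> \<otimes> \<gamma> \<otimes> \<T> \<gamma> = \<gamma> \<otimes> \<gamma>"
    and gamma_eta: "\<gamma> \<otimes> \<eta> = \<Q> \<eta>"
    and epsilon_gamma: "\<epsilon> \<otimes> \<gamma> = \<T> \<epsilon>"
    and epsilon_gamma_eta: "\<Q> \<epsilon> \<otimes> \<gamma> \<otimes> \<T> \<eta> = \<one>"
    and epsilon_eta: "\<epsilon> \<otimes> \<eta> = \<one>"

definition skew_mu :: "('a, 'x) skew_monoid_scheme \<Rightarrow> 'a" (\<open>\<mu>\<index>\<close>) where
  "\<mu>\<^bsub>A\<^esub> = \<Q>\<^bsub>A\<^esub> \<epsilon>\<^bsub>A\<^esub> \<otimes>\<^bsub>A\<^esub> \<gamma>\<^bsub>A\<^esub>"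

definition skew_delta :: "('a, 'x) skew_monoid_scheme \<Rightarrow> 'a" (\<open>\<delta>\<index>\<close>) where
  "\<delta>\<^bsub>A\<^esub> = \<gamma>\<^bsub>A\<^esub> \<otimes>\<^bsub>A\<^esub> \<T>\<^bsub>A\<^esub> \<eta>\<^bsub>A\<^esub>"

definition skew_S :: "('a, 'x) skew_monoid_scheme \<Rightarrow> 'a \<Rightarrow> 'a" (\<open>\<S>\<index>\<close>) where
  "\<S>\<^bsub>A\<^esub> a = \<mu>\<^bsub>A\<^esub> \<otimes>\<^bsub>A\<^esub> \<T>\<^bsub>A\<^esub> (\<Q>\<^bsub>A\<^esub> a \<otimes>\<^bsub>A\<^esub> \<eta>\<^bsub>A\<^esub>)"

definition module_cat :: "('a, 'x) skew_monoid_scheme \<Rightarrow> ('a, 'a) cat" where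
  "module_cat A = \<lparr>
     obj = {x \<in> carrier A. x \<otimes>\<^bsub>A\<^esub> \<mu>\<^bsub>A\<^esub> = x \<otimes>\<^bsub>A\<^esub> \<T>\<^bsub>A\<^esub> x \<and> x \<otimes>\<^bsub>A\<^esub> \<eta>\<^bsub>A\<^esub> = \<one>\<^bsub>A\<^esub>},
     mor = (\<lambda>x y. {t \<in> carrier A. t \<otimes>\<^bsub>A\<^esub> x = y \<otimes>\<^bsub>A\<^esub> \<T>\<^bsub>A\<^esub> t}),
     idt = (\<lambda>x. \<one>\<^bsub>A\<^esub>),
     cmp = (\<lambda>x y z g f. g \<otimes>\<^bsub>A\<^esub> f)\<rparr>"

definition G_monoid :: "('a, 'x) skew_monoid_scheme \<Rightarrow> 'a monoid" where
  "G_monoid A = \<lparr>carrier = mor (module_cat A) \<mu>\<^bsub>A\<^esub> \<mu>\<^bsub>A\<^esub>, mult = mult A, one = \<one>\<^bsub>A\<^esub>\<rparr>"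

definition G_source :: "('a, 'x) skew_monoid_scheme \<Rightarrow> 'a \<Rightarrow> 'a" where
  "G_source A a = \<T>\<^bsub>A\<^esub> a"

definition G_target :: "('a, 'x) skew_monoid_scheme \<Rightarrow> 'a \<Rightarrow> 'a" where
  "G_target A a = \<S>\<^bsub>A\<^esub> a"

definition G_comult :: "('a, 'x) skew_monoid_scheme \<Rightarrow> 'a \<Rightarrow> ('a \<times> 'a) set" where
  "G_comult A = (\<lambda>g\<in>carrier (G_monoid A).
     tens A (bialgebroid_biset (G_monoid A) (G_source A) (G_target A))
       (bialgebroid_biset (G_monoid A) (G_source A) (G_target A))
       \<mu>\<^bsub>A\<^esub> (\<mu>\<^bsub>A\<^esub> \<otimes>\<^bsub>A\<^esub> \<T>\<^bsub>A\<^esub> (\<delta>\<^bsub>A\<^esub> \<otimes>\<^bsub>A\<^esub> g \<otimes>\<^bsub>A\<^esub> \<eta>\<^bsub>A\<^esub>)))"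

definition G_counit :: "('a, 'x) skew_monoid_scheme \<Rightarrow> 'a \<Rightarrow> 'a" where
  "G_counit A = (\<lambda>g\<in>carrier (G_monoid A). \<epsilon>\<^bsub>A\<^esub> \<otimes>\<^bsub>A\<^esub> g \<otimes>\<^bsub>A\<^esub> \<eta>\<^bsub>A\<^esub>)"

text \<open>
  The functor represented by \<open>\<mu>\<close>, first with values in bisets, then in right \<open>G\<close>-sets. An arrow
  acts by postcomposition, which is left multiplication.
\<close>

definition hom_biset_functor :: "('a, 'x) skew_monoid_scheme
    \<Rightarrow> ('a, 'a, ('a, 'a) biset, 'a \<Rightarrow> 'a) func" where
  "hom_biset_functor A = \<lparr>
     on_obj = (\<lambda>x. \<lparr>bcar = mor (module_cat A) \<mu>\<^bsub>A\<^esub> x,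
       lact = (\<lambda>a t. t \<otimes>\<^bsub>A\<^esub> \<S>\<^bsub>A\<^esub> a), ract = (\<lambda>t a. t \<otimes>\<^bsub>A\<^esub> \<T>\<^bsub>A\<^esub> a)\<rparr>),
     on_mor = (\<lambda>x y f. \<lambda>t\<in>mor (module_cat A) \<mu>\<^bsub>A\<^esub> x. f \<otimes>\<^bsub>A\<^esub> t)\<rparr>"

definition hom_gset_functor :: "('a, 'x) skew_monoid_scheme
    \<Rightarrow> ('a, 'a, ('a, 'a) gset, 'a \<Rightarrow> 'a) func" where
  "hom_gset_functor A = \<lparr>
     on_obj = (\<lambda>x. \<lparr>gcar = mor (module_cat A) \<mu>\<^bsub>A\<^esub> x, gact = (\<lambda>t g. t \<otimes>\<^bsub>A\<^esub> g)\<rparr>),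
     on_mor = (\<lambda>x y f. \<lambda>t\<in>mor (module_cat A) \<mu>\<^bsub>A\<^esub> x. f \<otimes>\<^bsub>A\<^esub> t)\<rparr>"

end

theory Submission
  imports Defs
begin

text \<open>
  Since \<open>\<mu> T(\<eta>) = 1\<close>, each hom-set \<open>x T(A)\<close> is a free right \<open>A\<close>-set on the single generator \<open>x\<close>,
  with coordinate map \<open>t \<mapsto> t \<eta>\<close>. In the coordinate, \<open>G\<close> is the biset \<open>A\<close> with \<open>a \<cdot> b = Q(a) b\<close>
  and \<open>b \<cdot> a = b a\<close>, so the class of \<open>p \<otimes> q\<close> in \<open>G \<otimes>\<^sub>A G\<close> is determined by the element
  \<open>Q(p \<eta>) (q \<eta>)\<close> of \<open>A\<close>. The coproduct becomes left multiplication by \<open>\<delta>\<close>, the counit left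
  multiplication by \<open>\<epsilon>\<close>, and every bialgebroid axiom an identity in \<open>A\<close>. Full faithfulness
  holds because a \<open>G\<close>-map \<open>h\<close> out of \<open>x T(A)\<close> is determined by \<open>h(x)\<close>: as \<open>x \<mu> = x T(x)\<close> with
  \<open>\<mu>, T(x) \<in> G\<close>, also \<open>h(x) \<mu> = h(x) T(x)\<close>, so \<open>f = h(x) \<eta>\<close> satisfies \<open>f x = h(x) = y T(f)\<close>.
\<close>

section \<open>Tensor products of bisets\<close>

locale two_bisets = M: is_biset A M + N: is_biset A N
  for A (structure) and M :: "('a, 'm) biset" and N :: "('a, 'n) biset"
begin

lemma equiv_tensor_rel: "equiv (bcar M \<times> bcar N) (tensor_rel A M N)"
proof (rule equivI)
  show "tensor_rel A M N \<subseteq> (bcar M \<times> bcar N) \<times> (bcar M \<times> bcar N)"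
    by (auto simp: tensor_rel_def)
  show "refl_on (bcar M \<times> bcar N) (tensor_rel A M N)"
    by (auto simp: tensor_rel_def refl_on_def)
  show "sym (tensor_rel A M N)"
    by (auto simp: tensor_rel_def sym_def intro: equivclp_sym)
  show "trans (tensor_rel A M N)"
    by (auto simp: tensor_rel_def trans_def intro: equivclp_trans)
qed

lemma mem_tens_iff:
  "(m', n') \<in> tens A M N m n \<longleftrightarrow> ((m, n), (m', n')) \<in> tensor_rel A M N"
  by (simp add: tens_def)

lemma mem_tens_self: "\<lbrakk>m \<in> bcar M; n \<in> bcar N\<rbrakk> \<Longrightarrow> (m, n) \<in> tens A M N m n"
  by (simp add: mem_tens_iff tensor_rel_def)

lemma tens_closed: "\<lbrakk>m \<in> bcar M; n \<in> bcar N\<rbrakk> \<Longrightarrow> tens A M N m n \<in> bcar (tensor A M N)"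
  by (auto simp: tensor_def tens_def intro: quotientI)

lemma tensor_cases:
  assumes "X \<in> bcar (tensor A M N)"
  obtains m n where "m \<in> bcar M" "n \<in> bcar N" "X = tens A M N m n"
  using assms by (auto simp: tensor_def tens_def elim!: quotientE)

lemma tens_balanced:
  assumes "m \<in> bcar M" "n \<in> bcar N" "a \<in> carrier A"
  shows "tens A M N (ract M m a) n = tens A M N m (lact N a n)"
proof -
  have "tensor_gen A M N (ract M m a, n) (m, lact N a n)"
    using assms unfolding tensor_gen_def by blast
  then have "((ract M m a, n), (m, lact N a n)) \<in> tensor_rel A M N"
    using assms M.ract_closed N.lact_closed by (simp add: tensor_rel_def r_into_equivclp)
  then show ?thesis
    unfolding tens_def by (rule equiv_class_eq[OF equiv_tensor_rel])
qed

text \<open>\<open>tensor_rel\<close> is the equivalence closure of \<open>tensor_gen\<close>, so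
  agreement of \<open>h\<close> across one generating step propagates along chains of steps.
  Well-definedness of the maps out of tensor products below rests on this.\<close>

lemma tens_invariant:
  assumes h: "\<And>m n a. \<lbrakk>m \<in> bcar M; n \<in> bcar N; a \<in> carrier A\<rbrakk>
      \<Longrightarrow> h (ract M m a) n = h m (lact N a n)"
    and "(m', n') \<in> tens A M N m n"
  shows "h m' n' = h m n"
proof -
  have "equivclp (tensor_gen A M N) (m, n) (m', n')"
    using assms(2) by (simp add: mem_tens_iff tensor_rel_def)
  then have "case_prod h (m', n') = case_prod h (m, n)"
  proof (induction rule: equivclp_induct)
    case (step y z)
    then show ?case using h by (auto simp: tensor_gen_def)
  qed simp
  then show ?thesis by simp
qed

text \<open>The set-valued \<open>h\<close> is constant on the class, and the class is inhabited by
  \<open>(m, n)\<close>, so the union over representatives collapses to one value. This evaluates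
  the union-style definitions on pure tensors.\<close>

lemma tens_lift:
  assumes "\<And>m n a. \<lbrakk>m \<in> bcar M; n \<in> bcar N; a \<in> carrier A\<rbrakk>
      \<Longrightarrow> h (ract M m a) n = h m (lact N a n)"
    and "m \<in> bcar M" "n \<in> bcar N"
  shows "(\<Union>(m', n')\<in>tens A M N m n. h m' n') = h m n"
  using tens_invariant[of h, OF assms(1)] mem_tens_self[OF assms(2,3)] by blast

text \<open>The two actions on \<open>M\<close> commute, so acting on the left factor respects the
  balancing relation.\<close>

lemma lact_tens:
  assumes "a \<in> carrier A" "m \<in> bcar M" "n \<in> bcar N"
  shows "lact (tensor A M N) a (tens A M N m n) = tens A M N (lact M a m) n"
  using assms
  by (simp add: tensor_def)
    (rule tens_lift, auto simp: M.lact_closed tens_balanced simp flip: M.lact_ract)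

lemma ract_tens:
  assumes "a \<in> carrier A" "m \<in> bcar M" "n \<in> bcar N"
  shows "ract (tensor A M N) (tens A M N m n) a = tens A M N m (ract N n a)"
  using assms
  by (simp add: tensor_def)
    (rule tens_lift, auto simp: N.lact_ract N.ract_closed tens_balanced)

lemma is_biset_tensor: "is_biset A (tensor A M N)"
  by unfold_locales
    (auto elim!: tensor_cases simp: lact_tens ract_tens tens_closed
      M.lact_closed N.ract_closed M.lact_one N.ract_one M.lact_mult N.ract_mult)

text \<open>Right linearity of \<open>f\<close> and left linearity of \<open>g\<close> carry a
  balancing step in the source to one in the target.\<close>

lemma tensor_map_tens:
  assumes "is_biset A M1" "is_biset A N1"
    and f: "f \<in> biset_hom A M M1" and g: "g \<in> biset_hom A N N1"
    and "m \<in> bcar M" "n \<in> bcar N"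
  shows "tensor_map A M N M1 N1 f g (tens A M N m n) = tens A M1 N1 (f m) (g n)"
proof -
  interpret T: two_bisets A M1 N1 using assms(1,2) by (rule two_bisets.intro)
  have "tens A M1 N1 (f (ract M m a)) (g n) = tens A M1 N1 (f m) (g (lact N a n))"
    if "m \<in> bcar M" "n \<in> bcar N" "a \<in> carrier A" for m n a
    using that f g T.tens_balanced[of "f m" "g n" a] by (auto simp: biset_hom_def)
  then have "(\<Union>(m', n')\<in>tens A M N m n. tens A M1 N1 (f m') (g n')) = tens A M1 N1 (f m) (g n)"
    using assms(5,6) by (rule tens_lift)
  then show ?thesis
    using assms(5,6) by (simp add: tensor_map_def tens_closed)
qed

text \<open>Descent happens twice: over the inner tensor product with \<open>p\<close> fixed, then
  over the outer one with \<open>Y\<close> itself a class.\<close>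

lemma tensor_assoc_tens:
  assumes "is_biset A P" "m \<in> bcar M" "n \<in> bcar N" "p \<in> bcar P"
  shows "tensor_assoc A M N P (tens A (tensor A M N) P (tens A M N m n) p)
    = tens A M (tensor A N P) m (tens A N P n p)"
proof -
  interpret P: is_biset A P by fact
  interpret NP: two_bisets A N P by unfold_locales
  interpret MN_P: two_bisets A "tensor A M N" P
    using is_biset_tensor P.is_biset_axioms by (rule two_bisets.intro)
  interpret M_NP: two_bisets A M "tensor A N P"
    using M.is_biset_axioms NP.is_biset_tensor by (rule two_bisets.intro)
  define h where "h Y p = (\<Union>(m, n)\<in>Y. tens A M (tensor A N P) m (tens A N P n p))" for Y p
  have h: "h (tens A M N m n) p = tens A M (tensor A N P) m (tens A N P n p)"
    if "m \<in> bcar M" "n \<in> bcar N" "p \<in> bcar P" for m n p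
    unfolding h_def using that
    by (intro tens_lift) (auto simp: M_NP.tens_balanced NP.lact_tens NP.tens_closed)
  \<comment> \<open>For \<open>Y\<close> the class of \<open>(m, n)\<close>, the scalar acts on
    \<open>n\<close> and can then cross to \<open>p\<close> inside the tensor product of
    \<open>N\<close> and \<open>P\<close>.\<close>
  have "h (ract (tensor A M N) Y a) p = h Y (lact P a p)"
    if "Y \<in> bcar (tensor A M N)" "p \<in> bcar P" "a \<in> carrier A" for Y p a
    using that by (auto elim!: tensor_cases
        simp: ract_tens h N.ract_closed P.lact_closed NP.tens_balanced)
  then have "(\<Union>(Y, p)\<in>tens A (tensor A M N) P (tens A M N m n) p. h Y p) = h (tens A M N m n) p"
    using tens_closed[OF assms(2,3)] assms(4) by (rule MN_P.tens_lift)
  then show ?thesis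
    using assms by (simp add: tensor_assoc_def h_def[symmetric] h MN_P.tens_closed tens_closed)
qed

end

section \<open>Unit constraints of the tensor product\<close>

context is_biset
begin

lemma is_biset_tensor_unit: "is_biset A (tensor_unit A)"
  by unfold_locales (auto simp: tensor_unit_def m_assoc)

text \<open>\<open>the_elem\<close> is meaningful only on a singleton: the action map is balanced by
  \<open>lact_mult\<close>, so all representatives of the class have the same image.\<close>

lemma tensor_lunit_tens:
  assumes "a \<in> carrier A" "m \<in> bcar M"
  shows "tensor_lunit A M (tens A (tensor_unit A) M a m) = lact M a m"
proof -
  interpret two_bisets A "tensor_unit A" M
    using is_biset_tensor_unit is_biset_axioms by (rule two_bisets.intro)
  have a: "a \<in> bcar (tensor_unit A)" using assms by (simp add: tensor_unit_def)
  have "lact M a' m' = lact M a m" if "(a', m') \<in> tens A (tensor_unit A) M a m" for a' m'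
    by (rule tens_invariant[where h = "lact M", OF _ that]) (auto simp: tensor_unit_def lact_mult)
  then have "(\<lambda>(a, m). lact M a m) ` tens A (tensor_unit A) M a m \<subseteq> {lact M a m}"
    by auto
  moreover have "lact M a m \<in> (\<lambda>(a, m). lact M a m) ` tens A (tensor_unit A) M a m"
    using mem_tens_self[OF a assms(2)] by (rule rev_image_eqI) simp
  ultimately have "(\<lambda>(a, m). lact M a m) ` tens A (tensor_unit A) M a m = {lact M a m}"
    by blast
  then show ?thesis
    using tens_closed[OF a assms(2)] by (simp add: tensor_lunit_def)
qed

lemma tensor_runit_tens:
  assumes "a \<in> carrier A" "m \<in> bcar M"
  shows "tensor_runit A M (tens A M (tensor_unit A) m a) = ract M m a"
proof -
  interpret two_bisets A M "tensor_unit A"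
    using is_biset_axioms is_biset_tensor_unit by (rule two_bisets.intro)
  have a: "a \<in> bcar (tensor_unit A)" using assms by (simp add: tensor_unit_def)
  have "ract M m' a' = ract M m a" if "(m', a') \<in> tens A M (tensor_unit A) m a" for a' m'
    by (rule tens_invariant[where h = "ract M", OF _ that]) (auto simp: tensor_unit_def ract_mult)
  then have "(\<lambda>(m, a). ract M m a) ` tens A M (tensor_unit A) m a \<subseteq> {ract M m a}"
    by auto
  moreover have "ract M m a \<in> (\<lambda>(m, a). ract M m a) ` tens A M (tensor_unit A) m a"
    using mem_tens_self[OF assms(2) a] by (rule rev_image_eqI) simp
  ultimately have "(\<lambda>(m, a). ract M m a) ` tens A M (tensor_unit A) m a = {ract M m a}"
    by blast
  then show ?thesis
    using tens_closed[OF assms(2) a] by (simp add: tensor_runit_def)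
qed

end

section \<open>Categories of bisets and of right G-sets\<close>

lemma is_functor_func_comp:
  assumes "is_functor C D F" "is_functor D E H"
  shows "is_functor C E (func_comp H F)"
proof -
  interpret F: is_functor C D F by fact
  interpret H: is_functor D E H by fact
  show ?thesis
    by unfold_locales
      (simp_all add: func_comp_def F.on_obj_closed F.on_mor_closed F.on_mor_idt F.on_mor_cmp
        H.on_obj_closed H.on_mor_closed H.on_mor_idt H.on_mor_cmp)
qed

lemma is_category_biset_cat:
  assumes "monoid A" shows "is_category (biset_cat A)"
proof -
  interpret monoid A by fact
  show ?thesis
    by unfold_locales
      (auto simp: biset_cat_def biset_hom_def compose_def is_biset.lact_closed is_biset.ract_closed
        fun_eq_iff PiE_def Pi_def extensional_def)
qed

lemma is_category_gset_cat:
  assumes "monoid G" shows "is_category (gset_cat G)"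
proof -
  interpret monoid G by fact
  show ?thesis
    by unfold_locales
      (auto simp: gset_cat_def gset_hom_def compose_def is_right_gset.gact_closed
        fun_eq_iff PiE_def Pi_def extensional_def)
qed

section \<open>Restriction of right G-sets to bisets\<close>

context right_bialgebroid
begin

lemma source_closed: "a \<in> carrier A \<Longrightarrow> s a \<in> carrier G"
  and source_one: "s \<one>\<^bsub>A\<^esub> = \<one>\<^bsub>G\<^esub>"
  and source_mult: "\<lbrakk>a \<in> carrier A; b \<in> carrier A\<rbrakk> \<Longrightarrow> s (a \<otimes>\<^bsub>A\<^esub> b) = s a \<otimes>\<^bsub>G\<^esub> s b"
  using source by (auto simp: monoid_mor_def hom_def)

lemma target_closed: "a \<in> carrier A \<Longrightarrow> t a \<in> carrier G"
  and target_one: "t \<one>\<^bsub>A\<^esub> = \<one>\<^bsub>G\<^esub>"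
  and target_mult: "\<lbrakk>a \<in> carrier A; b \<in> carrier A\<rbrakk> \<Longrightarrow> t (a \<otimes>\<^bsub>A\<^esub> b) = t b \<otimes>\<^bsub>G\<^esub> t a"
  using target by (auto simp: monoid_mor_def hom_def opp_def)

text \<open>The target reverses products, so acting through it on the right is a left action; it
  commutes with the action through the source because the images of both maps commute.\<close>

lemma is_biset_forget:
  assumes "is_right_gset G M"
  shows "is_biset A (on_obj (bialgebroid_forget s t) M)"
proof -
  interpret M: is_right_gset G M by fact
  show ?thesis
    by unfold_locales
      (auto simp: bialgebroid_forget_def source_closed target_closed source_one target_one
        source_mult target_mult M.gact_closed M.gact_one M.gact_mult source_target
        simp flip: M.gact_mult)
qed

lemma is_functor_forget: "is_functor (gset_cat G) (biset_cat A) (bialgebroid_forget s t)"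
proof -
  interpret C: is_category "gset_cat G" by (rule is_category_gset_cat) unfold_locales
  interpret D: is_category "biset_cat A" by (rule is_category_biset_cat) unfold_locales
  show ?thesis
  proof
    fix M assume "M \<in> obj (gset_cat G)"
    then show "on_obj (bialgebroid_forget s t) M \<in> obj (biset_cat A)"
      using is_biset_forget by (simp add: gset_cat_def biset_cat_def)
  qed (auto simp: gset_cat_def biset_cat_def bialgebroid_forget_def gset_hom_def biset_hom_def
      source_closed target_closed)
qed

end

section \<open>Skew monoidal monoids\<close>

context skew_monoidal_monoid
begin

lemma T_closed [simp]: "a \<in> carrier A \<Longrightarrow> \<T> a \<in> carrier A"
  and T_one [simp]: "\<T> \<one> = \<one>"
  and T_mult [simp]: "\<lbrakk>a \<in> carrier A; b \<in> carrier A\<rbrakk> \<Longrightarrow> \<T> (a \<otimes> b) = \<T> a \<otimes> \<T> b"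
  using T_mor by (auto simp: monoid_mor_def hom_def)

lemma Q_closed [simp]: "a \<in> carrier A \<Longrightarrow> \<Q> a \<in> carrier A"
  and Q_one [simp]: "\<Q> \<one> = \<one>"
  and Q_mult [simp]: "\<lbrakk>a \<in> carrier A; b \<in> carrier A\<rbrakk> \<Longrightarrow> \<Q> (a \<otimes> b) = \<Q> a \<otimes> \<Q> b"
  using Q_mor by (auto simp: monoid_mor_def hom_def)

lemmas [simp] = gamma_closed eta_closed epsilon_closed

lemma mu_closed [simp]: "\<mu> \<in> carrier A"
  and delta_closed [simp]: "\<delta> \<in> carrier A"
  by (simp_all add: skew_mu_def skew_delta_def)

lemma S_closed [simp]: "a \<in> carrier A \<Longrightarrow> \<S> a \<in> carrier A"
  by (simp add: skew_S_def)

text \<open>Once \<open>m_assoc\<close> has nested products to the right, the factor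
  \<open>x \<otimes> y\<close> is no longer a subterm; this form of an identity still rewrites
  there.\<close>

lemma assoc_extend:
  assumes "x \<otimes> y = z" "x \<in> carrier A" "y \<in> carrier A" "c \<in> carrier A"
  shows "x \<otimes> (y \<otimes> c) = z \<otimes> c"
  using assms by (simp flip: m_assoc)

section \<open>Identities for \<mu>, \<delta> and S\<close>

lemma T_eta: "a \<in> carrier A \<Longrightarrow> \<T> a \<otimes> \<eta> = \<eta> \<otimes> a"
  by (simp add: eta_nat)

lemma mu_eta: "\<mu> \<otimes> \<eta> = \<one>"
  by (simp add: skew_mu_def m_assoc gamma_eta epsilon_eta flip: Q_mult)

lemma mu_T_eta: "\<mu> \<otimes> \<T> \<eta> = \<one>"
  by (simp add: skew_mu_def epsilon_gamma_eta)

lemma mu_T_T: "a \<in> carrier A \<Longrightarrow> \<mu> \<otimes> \<T> (\<T> a) = \<T> a \<otimes> \<mu>"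
  by (simp add: skew_mu_def m_assoc gamma_T_T assoc_extend[OF T_Q])

lemma mu_Q: "a \<in> carrier A \<Longrightarrow> \<mu> \<otimes> \<Q> a = \<Q> a \<otimes> \<mu>"
  by (simp add: skew_mu_def m_assoc gamma_Q epsilon_nat assoc_extend flip: Q_mult)

lemma gamma_Q_T_eps: "\<gamma> \<otimes> \<T> (\<Q> \<epsilon>) = \<Q> (\<epsilon> \<otimes> \<gamma>) \<otimes> \<gamma>"
  by (simp only: gamma_T_Q epsilon_closed epsilon_gamma)

text \<open>This is the pentagon multiplied on the left by \<open>\<Q> \<epsilon>\<close>: the
  factor \<open>\<Q> (\<epsilon> \<otimes> \<gamma>)\<close> that arises is absorbed by
  \<open>gamma_Q_T_eps\<close>.\<close>

lemma mu_gamma: "\<mu> \<otimes> \<gamma> = \<gamma> \<otimes> \<T> \<mu>"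
proof -
  have "\<mu> \<otimes> \<gamma> = \<Q> \<epsilon> \<otimes> (\<Q> \<gamma> \<otimes> \<gamma> \<otimes> \<T> \<gamma>)"
    by (simp add: skew_mu_def m_assoc pentagon)
  also have "\<dots> = \<Q> (\<epsilon> \<otimes> \<gamma>) \<otimes> \<gamma> \<otimes> \<T> \<gamma>"
    by (simp add: m_assoc)
  also have "\<dots> = \<gamma> \<otimes> \<T> (\<Q> \<epsilon>) \<otimes> \<T> \<gamma>"
    by (simp only: gamma_Q_T_eps)
  finally show ?thesis by (simp add: skew_mu_def m_assoc)
qed

text \<open>\<open>mu_gamma\<close> multiplied on the left by \<open>\<Q> \<epsilon>\<close>, which
  commutes with \<mu>. It makes \<mu> an object of the module category.\<close>

lemma mu_T_mu: "\<mu> \<otimes> \<T> \<mu> = \<mu> \<otimes> \<mu>"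
proof -
  have "\<mu> \<otimes> \<T> \<mu> = \<Q> \<epsilon> \<otimes> (\<mu> \<otimes> \<gamma>)"
    by (subst mu_gamma) (simp add: skew_mu_def m_assoc)
  also have "\<dots> = (\<mu> \<otimes> \<Q> \<epsilon>) \<otimes> \<gamma>"
    by (simp only: mu_Q epsilon_closed) (simp add: m_assoc)
  also have "\<dots> = \<mu> \<otimes> \<mu>"
    by (simp add: skew_mu_def m_assoc)
  finally show ?thesis .
qed

lemma epsilon_mu: "\<epsilon> \<otimes> \<mu> = \<epsilon> \<otimes> \<T> \<epsilon>"
proof -
  have "\<epsilon> \<otimes> \<mu> = \<epsilon> \<otimes> \<epsilon> \<otimes> \<gamma>"
    by (simp add: skew_mu_def epsilon_nat m_assoc)
  then show ?thesis by (simp add: m_assoc epsilon_gamma)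
qed

lemma delta_Q: "a \<in> carrier A \<Longrightarrow> \<delta> \<otimes> \<Q> a = \<Q> (\<Q> a) \<otimes> \<delta>"
  by (simp add: skew_delta_def m_assoc T_Q assoc_extend[OF gamma_Q])

lemma T_delta: "a \<in> carrier A \<Longrightarrow> \<T> a \<otimes> \<delta> = \<gamma> \<otimes> \<T> (\<eta> \<otimes> a)"
  by (simp only: eta_nat) (simp add: skew_delta_def m_assoc assoc_extend[OF gamma_T_T])

lemma delta_eta: "\<delta> \<otimes> \<eta> = \<Q> \<eta> \<otimes> \<eta>"
  by (simp add: skew_delta_def m_assoc T_eta) (simp add: assoc_extend[OF gamma_eta])

lemma epsilon_delta: "\<epsilon> \<otimes> \<delta> = \<one>"
  by (simp add: skew_delta_def assoc_extend[OF epsilon_gamma] epsilon_eta flip: T_mult)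

lemma Q_epsilon_delta: "\<Q> \<epsilon> \<otimes> \<delta> = \<one>"
  using epsilon_gamma_eta by (simp add: skew_delta_def m_assoc)

text \<open>Coassociativity in coordinates. The pentagon supplies \<open>\<Q> \<gamma>\<close>, and
  \<open>gamma_eta\<close> turns the remaining \<gamma> under T into a \<open>\<Q> \<eta>\<close>
  that moves left across \<gamma>.\<close>

lemma delta_delta: "\<delta> \<otimes> \<delta> = \<Q> \<delta> \<otimes> \<delta>"
proof -
  have "\<delta> \<otimes> \<delta> = \<gamma> \<otimes> (\<T> \<eta> \<otimes> \<delta>)"
    by (simp add: skew_delta_def m_assoc)
  also have "\<dots> = \<Q> \<gamma> \<otimes> \<gamma> \<otimes> \<T> (\<gamma> \<otimes> \<eta>) \<otimes> \<T> \<eta>"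
    by (simp add: T_delta assoc_extend[OF pentagon[symmetric]] m_assoc)
  also have "\<dots> = \<Q> \<gamma> \<otimes> \<Q> (\<T> \<eta>) \<otimes> \<gamma> \<otimes> \<T> \<eta>"
    by (simp add: gamma_eta m_assoc assoc_extend[OF gamma_T_Q])
  finally show ?thesis by (simp add: skew_delta_def m_assoc)
qed

text \<open>The coordinate form of multiplicativity of the coproduct, again the pentagon, now framed
  by \<open>\<Q> (\<Q> \<epsilon>)\<close> and \<open>\<T> (\<T> \<eta>)\<close>.\<close>

lemma delta_mu: "\<delta> \<otimes> \<mu> = \<Q> \<mu> \<otimes> \<gamma> \<otimes> \<T> \<delta>"
proof -
  have "\<delta> \<otimes> \<mu> = \<delta> \<otimes> \<Q> \<epsilon> \<otimes> \<gamma>"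
    by (simp add: skew_mu_def m_assoc)
  also have "\<dots> = \<Q> (\<Q> \<epsilon>) \<otimes> \<gamma> \<otimes> (\<T> \<eta> \<otimes> \<gamma>)"
    by (simp only: delta_Q epsilon_closed) (simp add: skew_delta_def m_assoc)
  also have "\<dots> = \<Q> (\<Q> \<epsilon>) \<otimes> (\<Q> \<gamma> \<otimes> \<gamma> \<otimes> \<T> \<gamma>) \<otimes> \<T> (\<T> \<eta>)"
    by (simp only: gamma_T_T[symmetric] eta_closed pentagon) (simp add: m_assoc)
  finally show ?thesis by (simp add: skew_mu_def skew_delta_def m_assoc)
qed

lemma S_eta: "a \<in> carrier A \<Longrightarrow> \<S> a \<otimes> \<eta> = \<Q> a \<otimes> \<eta>"
  by (simp add: skew_S_def m_assoc T_eta assoc_extend[OF mu_eta] assoc_extend[OF T_eta])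


text \<open>The coordinate form of the Takeuchi condition: \<open>mu_gamma\<close> moves \<mu> under
  T, where it cancels against \<eta>.\<close>

lemma S_delta: "a \<in> carrier A \<Longrightarrow> \<S> a \<otimes> \<delta> = \<Q> (\<T> a) \<otimes> \<delta>"
proof -
  assume a: "a \<in> carrier A"
  have "\<S> a \<otimes> \<delta> = \<mu> \<otimes> \<gamma> \<otimes> \<T> (\<eta> \<otimes> (\<Q> a \<otimes> \<eta>))"
    using a by (simp add: skew_S_def T_delta m_assoc del: T_mult)
  also have "\<dots> = \<gamma> \<otimes> \<T> (\<mu> \<otimes> \<eta> \<otimes> \<Q> a \<otimes> \<eta>)"
    using a by (simp add: mu_gamma m_assoc)
  also have "\<dots> = \<Q> (\<T> a) \<otimes> \<delta>"
    using a by (simp add: mu_eta skew_delta_def assoc_extend[OF gamma_T_Q] m_assoc)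
  finally show ?thesis .
qed

section \<open>The module category and its hom-sets out of \<mu>\<close>

lemma mem_obj:
  "x \<in> obj (module_cat A) \<longleftrightarrow> x \<in> carrier A \<and> x \<otimes> \<mu> = x \<otimes> \<T> x \<and> x \<otimes> \<eta> = \<one>"
  by (simp add: module_cat_def)

lemma mem_mor:
  "t \<in> mor (module_cat A) x y \<longleftrightarrow> t \<in> carrier A \<and> t \<otimes> x = y \<otimes> \<T> t"
  by (simp add: module_cat_def)

lemma mu_obj: "\<mu> \<in> obj (module_cat A)"
  by (simp add: mem_obj mu_eta mu_T_mu)

lemma free_coord:
  assumes "x \<in> obj (module_cat A)" "a \<in> carrier A"
  shows "x \<otimes> \<T> a \<otimes> \<eta> = a"
  using assms by (simp add: mem_obj m_assoc T_eta assoc_extend)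

lemma free_mem:
  assumes "x \<in> obj (module_cat A)" "a \<in> carrier A"
  shows "x \<otimes> \<T> a \<in> mor (module_cat A) \<mu> x"
proof -
  have x: "x \<in> carrier A" "x \<otimes> \<mu> = x \<otimes> \<T> x"
    using assms by (simp_all add: mem_obj)
  have "x \<otimes> \<T> a \<otimes> \<mu> = x \<otimes> \<mu> \<otimes> \<T> (\<T> a)"
    using assms(2) x(1) by (simp add: m_assoc mu_T_T)
  also have "\<dots> = x \<otimes> \<T> (x \<otimes> \<T> a)"
    using assms(2) x(1) by (simp add: x(2) m_assoc)
  finally show ?thesis
    using assms(2) x(1) by (simp add: mem_mor)
qed

text \<open>The arrow equation trades \<open>x \<otimes> \<T> t\<close> for
  \<open>t \<otimes> \<mu>\<close>, and \<open>mu_T_eta\<close> cancels the rest. With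
  \<open>free_coord\<close>, this makes \<open>t \<mapsto> t \<otimes> \<eta>\<close>
  bijective.\<close>

lemma free_expand:
  assumes "x \<in> obj (module_cat A)" "t \<in> mor (module_cat A) \<mu> x"
  shows "x \<otimes> \<T> (t \<otimes> \<eta>) = t"
proof -
  have *: "x \<in> carrier A" "t \<in> carrier A" "t \<otimes> \<mu> = x \<otimes> \<T> t"
    using assms by (simp_all add: mem_obj mem_mor)
  have "x \<otimes> \<T> (t \<otimes> \<eta>) = t \<otimes> \<mu> \<otimes> \<T> \<eta>"
    using *(1,2) by (simp add: *(3) m_assoc)
  also have "\<dots> = t"
    using *(1,2) by (simp add: m_assoc mu_T_eta)
  finally show ?thesis .
qed

lemma mor_closed: "t \<in> mor (module_cat A) x y \<Longrightarrow> t \<in> carrier A"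
  by (simp add: mem_mor)

lemma mor_mu_eq:
  assumes "x \<in> obj (module_cat A)"
  shows "mor (module_cat A) \<mu> x = {x \<otimes> \<T> a | a. a \<in> carrier A}"
proof
  show "mor (module_cat A) \<mu> x \<subseteq> {x \<otimes> \<T> a | a. a \<in> carrier A}"
    using free_expand[OF assms, symmetric] mor_closed m_closed eta_closed by blast
  show "{x \<otimes> \<T> a | a. a \<in> carrier A} \<subseteq> mor (module_cat A) \<mu> x"
    using free_mem[OF assms] by blast
qed

subsection \<open>The bialgebroid structure\<close>

text \<open>The inverse of the coordinate map on G: an element of G is named by its coordinate in
  A.\<close>

definition el :: "'a \<Rightarrow> 'a" where
  "el a = \<mu> \<otimes> \<T> a"

abbreviation G :: "'a monoid" where
  "G \<equiv> G_monoid A"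

abbreviation B :: "('a, 'a) biset" where
  "B \<equiv> bialgebroid_biset G (G_source A) (G_target A)"

lemma mult_G [simp]: "mult G = mult A"
  and one_G [simp]: "one G = \<one>"
  by (simp_all add: G_monoid_def)

lemma mem_G: "g \<in> carrier G \<longleftrightarrow> g \<in> carrier A \<and> g \<otimes> \<mu> = \<mu> \<otimes> \<T> g"
  by (simp add: G_monoid_def mem_mor)

lemma carrier_G: "carrier G = {\<mu> \<otimes> \<T> a | a. a \<in> carrier A}"
  using mor_mu_eq[OF mu_obj] by (simp add: G_monoid_def)

lemma G_in_A [simp]: "g \<in> carrier G \<Longrightarrow> g \<in> carrier A"
  by (simp add: mem_G)

lemma el_closed [simp]: "a \<in> carrier A \<Longrightarrow> el a \<in> carrier G"
  unfolding carrier_G el_def by blast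

lemma el_eta [simp]: "a \<in> carrier A \<Longrightarrow> el a \<otimes> \<eta> = a"
  using free_coord[OF mu_obj] by (simp add: el_def)

lemma el_coord [simp]: "g \<in> carrier G \<Longrightarrow> el (g \<otimes> \<eta>) = g"
  unfolding el_def by (rule free_expand[OF mu_obj]) (simp add: G_monoid_def)

lemma G_cases:
  assumes "g \<in> carrier G"
  obtains a where "a \<in> carrier A" "g = el a"
  using assms unfolding carrier_G el_def by blast

lemma G_eqI: "\<lbrakk>g \<in> carrier G; h \<in> carrier G; g \<otimes> \<eta> = h \<otimes> \<eta>\<rbrakk> \<Longrightarrow> g = h"
  by (metis el_coord)

lemma mor_comp:
  assumes "x \<in> carrier A" "y \<in> carrier A" "z \<in> carrier A"
    and "f \<in> mor (module_cat A) x y" "g \<in> mor (module_cat A) y z"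
  shows "g \<otimes> f \<in> mor (module_cat A) x z"
proof -
  have fg: "f \<in> carrier A" "g \<in> carrier A" "f \<otimes> x = y \<otimes> \<T> f" "g \<otimes> y = z \<otimes> \<T> g"
    using assms(4,5) by (simp_all add: mem_mor)
  have "g \<otimes> f \<otimes> x = (g \<otimes> y) \<otimes> \<T> f"
    using assms(1-3) fg(1,2) by (simp add: m_assoc fg(3))
  also have "\<dots> = z \<otimes> \<T> (g \<otimes> f)"
    using assms(1-3) fg(1,2) by (simp add: m_assoc fg(4))
  finally show ?thesis
    using fg(1,2) by (simp add: mem_mor)
qed

lemma submonoid_G: "submonoid (carrier G) A"
proof
  show "g \<otimes> h \<in> carrier G" if "g \<in> carrier G" "h \<in> carrier G" for g h
    using that mor_comp[of \<mu> \<mu> \<mu>] by (simp add: G_monoid_def)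
qed (auto simp: mem_G)

lemma G_mult_closed [simp]: "\<lbrakk>g \<in> carrier G; h \<in> carrier G\<rbrakk> \<Longrightarrow> g \<otimes> h \<in> carrier G"
  and one_in_G [simp]: "\<one> \<in> carrier G"
  using submonoid_G by (auto simp: submonoid_def)

lemma monoid_G: "monoid G"
  by (rule monoidI) (auto simp: m_assoc)

lemma T_in_G [simp]: "a \<in> carrier A \<Longrightarrow> \<T> a \<in> carrier G"
  by (simp add: mem_G mu_T_T)

lemma S_in_G [simp]: "a \<in> carrier A \<Longrightarrow> \<S> a \<in> carrier G"
  using el_closed[of "\<Q> a \<otimes> \<eta>"] by (simp add: skew_S_def el_def)

lemma mu_in_G [simp]: "\<mu> \<in> carrier G"
  by (simp add: mem_G mu_T_mu)

lemma el_one: "el \<one> = \<mu>"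
  by (simp add: el_def)

lemma el_T: "\<lbrakk>a \<in> carrier A; b \<in> carrier A\<rbrakk> \<Longrightarrow> el a \<otimes> \<T> b = el (a \<otimes> b)"
  by (simp add: el_def m_assoc)

text \<open>Coordinates decide equality in G, and \<open>\<Q> a\<close> commutes both with the image
  of T and with \<mu>, so it can be pulled to the front. This gives the left action of A in
  coordinates.\<close>

lemma el_S:
  assumes "a \<in> carrier A" "b \<in> carrier A"
  shows "el b \<otimes> \<S> a = el (\<Q> a \<otimes> b)"
proof (rule G_eqI)
  have "el b \<otimes> \<S> a \<otimes> \<eta> = \<mu> \<otimes> (\<T> b \<otimes> \<Q> a) \<otimes> \<eta>"
    using assms by (simp add: el_def m_assoc S_eta)
  also have "\<dots> = \<Q> a \<otimes> el b \<otimes> \<eta>"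
    using assms by (simp add: T_Q m_assoc el_def assoc_extend[OF mu_Q])
  finally show "el b \<otimes> \<S> a \<otimes> \<eta> = el (\<Q> a \<otimes> b) \<otimes> \<eta>"
    using assms by (simp add: m_assoc)
qed (use assms in auto)

text \<open>\<open>\<S> b\<close> is \<open>el\<close> of \<open>\<Q> b \<otimes> \<eta>\<close>, so
  \<open>el_S\<close> multiplies it by \<open>\<S> a\<close>.\<close>

lemma S_mult: "\<lbrakk>a \<in> carrier A; b \<in> carrier A\<rbrakk> \<Longrightarrow> \<S> (a \<otimes> b) = \<S> b \<otimes> \<S> a"
  using el_S[of a "\<Q> b \<otimes> \<eta>"] by (simp add: el_def skew_S_def m_assoc)

lemma S_one: "\<S> \<one> = \<one>"
  by (simp add: skew_S_def mu_T_eta)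

text \<open>\<open>\<T> a\<close> is \<open>el\<close> of \<open>\<eta> \<otimes> a\<close>, so
  \<open>el_S\<close> computes one side, and unfolding \<open>\<S> b\<close> the other.\<close>

lemma T_S: "\<lbrakk>a \<in> carrier A; b \<in> carrier A\<rbrakk> \<Longrightarrow> \<T> a \<otimes> \<S> b = \<S> b \<otimes> \<T> a"
  using el_S[of b "\<eta> \<otimes> a"]
  by (simp add: el_def skew_S_def m_assoc assoc_extend[OF mu_T_eta] flip: eta_nat)

section \<open>The biset G and its tensor square\<close>

lemma bcar_B [simp]: "bcar B = carrier G"
  and lact_B [simp]: "lact B a g = g \<otimes> \<S> a"
  and ract_B [simp]: "ract B g a = g \<otimes> \<T> a"
  by (simp_all add: bialgebroid_biset_def G_source_def G_target_def)

lemma is_biset_B: "is_biset A B"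
  by unfold_locales (auto simp: S_mult S_one m_assoc T_S)

sublocale BB: two_bisets A B B
  using is_biset_B is_biset_B by (rule two_bisets.intro)

text \<open>The displayed element is balanced: in coordinates b, c, moving a scalar a across the
  tensor sign gives \<open>\<Q> (b \<otimes> a) \<otimes> c\<close> on one side and
  \<open>\<Q> b \<otimes> (\<Q> a \<otimes> c)\<close> on the other.\<close>

lemma mem_tens_B:
  assumes "(p, q) \<in> tens A B B g h"
  shows "p \<in> carrier G" "q \<in> carrier G"
    "\<Q> (p \<otimes> \<eta>) \<otimes> (q \<otimes> \<eta>) = \<Q> (g \<otimes> \<eta>) \<otimes> (h \<otimes> \<eta>)"
proof -
  show "p \<in> carrier G" "q \<in> carrier G"
    using assms by (auto simp: BB.mem_tens_iff tensor_rel_def)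
  show "\<Q> (p \<otimes> \<eta>) \<otimes> (q \<otimes> \<eta>) = \<Q> (g \<otimes> \<eta>) \<otimes> (h \<otimes> \<eta>)"
  proof (rule BB.tens_invariant[where h = "\<lambda>p q. \<Q> (p \<otimes> \<eta>) \<otimes> (q \<otimes> \<eta>)", OF _ assms])
    fix p q a assume *: "p \<in> bcar B" "q \<in> bcar B" "a \<in> carrier A"
    then obtain b c where "b \<in> carrier A" "p = el b" "c \<in> carrier A" "q = el c"
      by (auto elim!: G_cases)
    then show "\<Q> (ract B p a \<otimes> \<eta>) \<otimes> (q \<otimes> \<eta>) = \<Q> (p \<otimes> \<eta>) \<otimes> (lact B a q \<otimes> \<eta>)"
      using *(3) by (simp add: el_T el_S m_assoc[of "\<Q> b"])
  qed
qed

text \<open>Write p as \<mu> acted on by its coordinate and slide that scalar across. Since the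
  class depends only on the resulting element of A, the invariant of \<open>mem_tens_B\<close> is
  complete.\<close>

lemma tens_B_normal:
  assumes "p \<in> carrier G" "q \<in> carrier G"
  shows "tens A B B p q = tens A B B \<mu> (el (\<Q> (p \<otimes> \<eta>) \<otimes> (q \<otimes> \<eta>)))"
proof -
  have "tens A B B p q = tens A B B (ract B \<mu> (p \<otimes> \<eta>)) q"
    using assms el_coord[of p] by (simp add: el_def del: el_coord)
  also have "\<dots> = tens A B B \<mu> (lact B (p \<otimes> \<eta>) q)"
    using assms by (intro BB.tens_balanced) auto
  also have "lact B (p \<otimes> \<eta>) q = el (\<Q> (p \<otimes> \<eta>) \<otimes> (q \<otimes> \<eta>))"
    using assms el_S[of "p \<otimes> \<eta>" "q \<otimes> \<eta>"] by simp
  finally show ?thesis .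
qed

section \<open>Coproduct, counit and the bialgebroid axioms\<close>

lemma comult_el: "a \<in> carrier A \<Longrightarrow> G_comult A (el a) = tens A B B \<mu> (el (\<delta> \<otimes> a))"
  by (simp add: G_comult_def m_assoc) (simp add: el_def)

lemma counit_el: "a \<in> carrier A \<Longrightarrow> G_counit A (el a) = \<epsilon> \<otimes> a"
  by (simp add: G_counit_def m_assoc)

lemma comult_hom: "G_comult A \<in> biset_hom A B (tensor A B B)"
proof -
  have "G_comult A (lact B a (el b)) = lact (tensor A B B) a (G_comult A (el b))"
    if "a \<in> carrier A" "b \<in> carrier A" for a b
  proof -
    have "lact (tensor A B B) a (G_comult A (el b)) = tens A B B (\<mu> \<otimes> \<S> a) (el (\<delta> \<otimes> b))"
      using that by (simp add: comult_el BB.lact_tens)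
    \<comment> \<open>\<open>el_S\<close> at coordinate 1 identifies
      \<open>\<mu> \<otimes> \<S> a\<close> with \<open>el (\<Q> a)\<close>, whose normal form
      contributes the second Q; \<open>delta_Q\<close> then gives left linearity.\<close>
    also have "\<dots> = tens A B B \<mu> (el (\<Q> (\<Q> a) \<otimes> \<delta> \<otimes> b))"
      using that el_S[of a \<one>] by (simp add: tens_B_normal[of "el (\<Q> a)"] el_one m_assoc)
    also have "\<dots> = G_comult A (lact B a (el b))"
      using that by (simp add: el_S comult_el m_assoc flip: delta_Q)
    finally show ?thesis ..
  qed
  moreover have "G_comult A (ract B (el b) a) = ract (tensor A B B) (G_comult A (el b)) a"
    if "a \<in> carrier A" "b \<in> carrier A" for a b
    using that by (simp add: comult_el BB.ract_tens el_T m_assoc)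
  moreover have "G_comult A \<in> extensional (carrier G)"
    by (simp add: G_comult_def)
  moreover have "G_comult A (el a) \<in> bcar (tensor A B B)" if "a \<in> carrier A" for a
    using that by (simp add: comult_el BB.tens_closed)
  ultimately show ?thesis
    by (auto simp: biset_hom_def PiE_def simp del: lact_B ract_B elim!: G_cases)
qed

lemma counit_hom: "G_counit A \<in> biset_hom A B (tensor_unit A)"
proof -
  have "G_counit A (lact B a (el b)) = lact (tensor_unit A) a (G_counit A (el b))"
    if "a \<in> carrier A" "b \<in> carrier A" for a b
    using that by (simp add: el_S counit_el tensor_unit_def m_assoc[symmetric] epsilon_nat)
  moreover have "G_counit A (ract B (el b) a) = ract (tensor_unit A) (G_counit A (el b)) a"
    if "a \<in> carrier A" "b \<in> carrier A" for a b
    using that by (simp add: el_T counit_el tensor_unit_def m_assoc)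
  moreover have "G_counit A \<in> extensional (carrier G)"
    by (simp add: G_counit_def)
  moreover have "G_counit A (el a) \<in> bcar (tensor_unit A)" if "a \<in> carrier A" for a
    using that by (simp add: counit_el tensor_unit_def)
  ultimately show ?thesis
    by (auto simp: biset_hom_def PiE_def simp del: lact_B ract_B elim!: G_cases)
qed

lemma id_hom: "(\<lambda>g\<in>carrier G. g) \<in> biset_hom A B B"
  by (auto simp: biset_hom_def)

text \<open>All three laws become identities in A: \<open>delta_delta\<close> for coassociativity,
  \<open>Q_epsilon_delta\<close> and \<open>epsilon_delta\<close> for the two counit laws.\<close>

lemma comonoid_G: "biset_comonoid A B (G_comult A) (G_counit A)"
proof -
  interpret U: is_biset A "tensor_unit A"
    by (rule BB.M.is_biset_tensor_unit)
  have mu: "G_comult A \<mu> = tens A B B \<mu> (el \<delta>)" "G_counit A \<mu> = \<epsilon>"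
    using comult_el[of \<one>] counit_el[of \<one>] by (simp_all add: el_one)
  show ?thesis
  proof
    fix g assume "g \<in> bcar B"
    then obtain a where a: "a \<in> carrier A" and g: "g = el a"
      by (auto elim: G_cases)
    have "tensor_assoc A B B B (tensor_map A B B (tensor A B B) B (G_comult A) (\<lambda>g\<in>bcar B. g) (G_comult A g))
        = tens A B (tensor A B B) \<mu> (tens A B B (el \<delta>) (el (\<delta> \<otimes> a)))"
      using a comult_hom id_hom by (simp add: g comult_el mu BB.tensor_map_tens BB.is_biset_tensor
          is_biset_B BB.tensor_assoc_tens)
    also have "tens A B B (el \<delta>) (el (\<delta> \<otimes> a)) = tens A B B \<mu> (el (\<Q> \<delta> \<otimes> \<delta> \<otimes> a))"
      using a by (simp add: tens_B_normal[of "el \<delta>"] m_assoc)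
    also have "\<dots> = G_comult A (el (\<delta> \<otimes> a))"
      using a by (simp add: comult_el m_assoc flip: delta_delta)
    also have "tens A B (tensor A B B) \<mu> \<dots>
        = tensor_map A B B B (tensor A B B) (\<lambda>g\<in>bcar B. g) (G_comult A) (G_comult A g)"
      using a comult_hom id_hom by (simp add: g comult_el[of a] BB.tensor_map_tens BB.is_biset_tensor
          is_biset_B)
    finally show "tensor_assoc A B B B (tensor_map A B B (tensor A B B) B (G_comult A) (\<lambda>g\<in>bcar B. g) (G_comult A g))
      = tensor_map A B B B (tensor A B B) (\<lambda>g\<in>bcar B. g) (G_comult A) (G_comult A g)" .
    show "tensor_lunit A B (tensor_map A B B (tensor_unit A) B (G_counit A) (\<lambda>g\<in>bcar B. g) (G_comult A g)) = g"
      using a counit_hom id_hom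
      by (simp add: g comult_el mu BB.tensor_map_tens is_biset_B U.is_biset_axioms
          BB.M.tensor_lunit_tens el_S assoc_extend[OF Q_epsilon_delta])
    show "tensor_runit A B (tensor_map A B B B (tensor_unit A) (\<lambda>g\<in>bcar B. g) (G_counit A) (G_comult A g)) = g"
      using a counit_hom id_hom
      by (simp add: g comult_el counit_el BB.tensor_map_tens is_biset_B U.is_biset_axioms
          BB.M.tensor_runit_tens assoc_extend[OF epsilon_delta]) (simp add: el_def)
  qed (use comult_hom counit_hom in auto)
qed

lemma right_bialgebroid_G:
  "right_bialgebroid A G (G_source A) (G_target A) (G_comult A) (G_counit A)"
proof -
  show ?thesis
  proof (intro right_bialgebroid.intro right_bialgebroid_axioms.intro monoid_axioms monoid_G)
    show "G_source A \<in> monoid_mor A G"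
      by (auto simp: monoid_mor_def hom_def G_source_def)
    show "G_target A \<in> monoid_mor (opp A) G"
      by (auto simp: monoid_mor_def hom_def opp_def G_target_def S_mult S_one)
    show "G_source A a \<otimes>\<^bsub>G\<^esub> G_target A b = G_target A b \<otimes>\<^bsub>G\<^esub> G_source A a"
      if "a \<in> carrier A" "b \<in> carrier A" for a b
      using that by (simp add: G_source_def G_target_def T_S)
    show "biset_comonoid A B (G_comult A) (G_counit A)"
      by (rule comonoid_G)
  next
    fix a g p q
    assume a: "a \<in> carrier A" and "g \<in> carrier G" and pq: "(p, q) \<in> G_comult A g"
    then obtain b where b: "b \<in> carrier A" "g = el b"
      by (auto elim: G_cases)
    \<comment> \<open>Only the invariant of the pair is known, since p and q form an arbitrary
      representative of the coproduct.\<close>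
    have pq: "p \<in> carrier G" "q \<in> carrier G" "\<Q> (p \<otimes> \<eta>) \<otimes> (q \<otimes> \<eta>) = \<delta> \<otimes> b"
      using mem_tens_B[of p q \<mu> "el (\<delta> \<otimes> b)"] pq b by (auto simp: comult_el mu_eta)
    have "\<Q> (\<T> a \<otimes> p \<otimes> \<eta>) \<otimes> (q \<otimes> \<eta>) = \<Q> (\<T> a) \<otimes> (\<Q> (p \<otimes> \<eta>) \<otimes> (q \<otimes> \<eta>))"
      using a pq(1,2) by (simp add: m_assoc)
    also have "\<dots> = \<S> a \<otimes> \<delta> \<otimes> b"
      using a b by (simp add: pq(3) S_delta m_assoc)
    also have "\<dots> = \<S> a \<otimes> \<Q> (p \<otimes> \<eta>) \<otimes> (q \<otimes> \<eta>)"
      using a b pq(1,2) by (simp add: m_assoc flip: pq(3))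
    \<comment> \<open>\<open>\<S> a\<close> is \<mu> times a value of T, and both factors commute
      with the image of Q.\<close>
    also have "\<S> a \<otimes> \<Q> (p \<otimes> \<eta>) = \<Q> (p \<otimes> \<eta>) \<otimes> \<S> a"
      using a pq(1,2) unfolding skew_S_def
      by (metis G_in_A Q_closed T_Q T_closed eta_closed m_assoc m_closed mu_Q mu_closed)
    finally have "\<Q> (\<T> a \<otimes> p \<otimes> \<eta>) \<otimes> (q \<otimes> \<eta>) = \<Q> (p \<otimes> \<eta>) \<otimes> (\<S> a \<otimes> q \<otimes> \<eta>)"
      using a pq(1,2) by (simp add: m_assoc)
    then show "tens A B B (G_source A a \<otimes>\<^bsub>G\<^esub> p) q = tens A B B p (G_target A a \<otimes>\<^bsub>G\<^esub> q)"
      using a pq(1,2) by (simp add: G_source_def G_target_def tens_B_normal[of "\<T> a \<otimes> p"]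
          tens_B_normal[of p])
  next
    fix g h p q r s
    assume "g \<in> carrier G" "h \<in> carrier G"
      and pq: "(p, q) \<in> G_comult A g" and rs: "(r, s) \<in> G_comult A h"
    then obtain a b where a: "a \<in> carrier A" "g = el a" and b: "b \<in> carrier A" "h = el b"
      by (auto elim!: G_cases)
    have pq: "p \<in> carrier G" "q \<in> carrier G" "\<Q> (p \<otimes> \<eta>) \<otimes> (q \<otimes> \<eta>) = \<delta> \<otimes> a"
      using mem_tens_B[of p q \<mu> "el (\<delta> \<otimes> a)"] pq a by (auto simp: comult_el mu_eta)
    have rs: "r \<in> carrier G" "s \<in> carrier G" "\<Q> (r \<otimes> \<eta>) \<otimes> (s \<otimes> \<eta>) = \<delta> \<otimes> b"
      using mem_tens_B[of r s \<mu> "el (\<delta> \<otimes> b)"] rs b by (auto simp: comult_el mu_eta)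
    define c d e f where "c = p \<otimes> \<eta>" "d = q \<otimes> \<eta>" "e = r \<otimes> \<eta>" "f = s \<otimes> \<eta>"
    have cl: "c \<in> carrier A" "d \<in> carrier A" "e \<in> carrier A" "f \<in> carrier A"
      using pq rs by (simp_all add: c_d_e_f_def)
    have el: "p = el c" "q = el d" "r = el e" "s = el f"
      using pq rs by (simp_all add: c_d_e_f_def)
    have cd: "\<Q> c \<otimes> d = \<delta> \<otimes> a" and ef: "\<Q> e \<otimes> f = \<delta> \<otimes> b"
      using pq rs by (simp_all add: c_d_e_f_def)
    have "\<Q> (p \<otimes> r \<otimes> \<eta>) \<otimes> (q \<otimes> s \<otimes> \<eta>) = \<Q> (el c \<otimes> e) \<otimes> (el d \<otimes> f)"
      using cl by (simp add: el m_assoc)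
    also have "\<dots> = \<Q> \<mu> \<otimes> \<Q> (\<T> c) \<otimes> (\<Q> e \<otimes> \<mu>) \<otimes> \<T> d \<otimes> f"
      using cl by (simp add: el_def m_assoc)
    \<comment> \<open>\<open>\<Q> e\<close> travels right past \<mu> and \<open>\<T> d\<close> to
      meet f, where the invariant of the second pair applies.\<close>
    also have "\<dots> = \<Q> \<mu> \<otimes> \<Q> (\<T> c) \<otimes> \<mu> \<otimes> (\<T> d \<otimes> \<Q> e) \<otimes> f"
      using cl by (simp only: T_Q mu_Q[symmetric]) (simp add: m_assoc)
    also have "\<dots> = \<Q> \<mu> \<otimes> \<Q> (\<T> c) \<otimes> \<mu> \<otimes> (\<T> d \<otimes> \<delta>) \<otimes> b"
      using cl b(1) by (simp add: m_assoc ef)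
    also have "\<dots> = \<Q> \<mu> \<otimes> \<Q> (\<T> c) \<otimes> (\<mu> \<otimes> \<gamma>) \<otimes> \<T> (\<eta> \<otimes> d) \<otimes> b"
      using cl b(1) by (simp add: m_assoc T_delta del: T_mult)
    \<comment> \<open>\<mu> passes under T and cancels \<eta>; then c also enters under T and meets
      d, so that the invariant of the first pair applies.\<close>
    also have "\<dots> = \<Q> \<mu> \<otimes> (\<Q> (\<T> c) \<otimes> \<gamma>) \<otimes> \<T> (\<mu> \<otimes> \<eta> \<otimes> d) \<otimes> b"
      using cl b(1) by (simp only: mu_gamma) (simp add: m_assoc)
    also have "\<dots> = \<Q> \<mu> \<otimes> \<gamma> \<otimes> \<T> (\<Q> c \<otimes> d) \<otimes> b"
      using cl b(1) by (simp only: gamma_T_Q[symmetric] mu_eta l_one) (simp add: m_assoc)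
    also have "\<dots> = (\<Q> \<mu> \<otimes> \<gamma> \<otimes> \<T> \<delta>) \<otimes> \<T> a \<otimes> b"
      using a(1) b(1) by (simp add: cd m_assoc)
    also have "\<dots> = \<delta> \<otimes> (el a \<otimes> b)"
      using a(1) b(1) by (simp only: delta_mu[symmetric]) (simp add: m_assoc el_def)
    finally have *: "\<Q> (p \<otimes> r \<otimes> \<eta>) \<otimes> (q \<otimes> s \<otimes> \<eta>) = \<delta> \<otimes> (el a \<otimes> b)" .
    \<comment> \<open>The coordinate of a product is the left factor applied to the coordinate of
      the right one.\<close>
    have "el a \<otimes> el b = el (el a \<otimes> b)"
      by (rule G_eqI) (use a(1) b(1) in \<open>simp_all add: m_assoc\<close>)
    then have "G_comult A (g \<otimes> h) = tens A B B \<mu> (el (\<delta> \<otimes> (el a \<otimes> b)))"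
      using a b by (simp add: comult_el)
    also have "\<dots> = tens A B B (p \<otimes> r) (q \<otimes> s)"
      using tens_B_normal[of "p \<otimes> r" "q \<otimes> s"] pq(1,2) rs(1,2) by (simp only: * G_mult_closed)
    finally show "G_comult A (g \<otimes>\<^bsub>G\<^esub> h) = tens A B B (p \<otimes>\<^bsub>G\<^esub> r) (q \<otimes>\<^bsub>G\<^esub> s)"
      by simp
  next
    \<comment> \<open>The unit of G has coordinate \<eta>, not 1; coordinate 1 belongs to
      \<mu>.\<close>
    have el: "el \<eta> = \<one>"
      by (simp add: el_def mu_T_eta)
    show "G_comult A \<one>\<^bsub>G\<^esub> = tens A B B \<one>\<^bsub>G\<^esub> \<one>\<^bsub>G\<^esub>"
      using comult_el[of \<eta>] by (simp add: el delta_eta tens_B_normal[of \<one>])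
    show "G_counit A \<one>\<^bsub>G\<^esub> = \<one>"
      using counit_el[of \<eta>] by (simp add: el epsilon_eta)
  next
    fix g h assume "g \<in> carrier G" "h \<in> carrier G"
    then obtain a b where a: "a \<in> carrier A" "g = el a" and b: "b \<in> carrier A" "h = el b"
      by (auto elim!: G_cases)
    \<comment> \<open>Both counit laws thus compare only \<open>\<epsilon> \<otimes> k\<close> for
      different left factors k; all of these reduce to
      \<open>\<epsilon> \<otimes> \<T> (\<epsilon> \<otimes> a)\<close>.\<close>
    have counit: "G_counit A (k \<otimes> h) = \<epsilon> \<otimes> k \<otimes> b" if "k \<in> carrier G" for k
      using that b by (simp add: G_counit_def m_assoc)
    have e_el: "\<epsilon> \<otimes> el c = \<epsilon> \<otimes> \<T> (\<epsilon> \<otimes> c)" if "c \<in> carrier A" for c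
      using that by (simp add: el_def m_assoc assoc_extend[OF epsilon_mu])
    show "G_counit A (G_source A (G_counit A g) \<otimes>\<^bsub>G\<^esub> h) = G_counit A (g \<otimes>\<^bsub>G\<^esub> h)"
      using a by (simp add: G_source_def counit counit_el e_el del: T_mult)
    have "\<epsilon> \<otimes> \<S> (\<epsilon> \<otimes> a) = \<epsilon> \<otimes> \<T> (\<epsilon> \<otimes> (\<Q> (\<epsilon> \<otimes> a) \<otimes> \<eta>))"
      using a e_el[of "\<Q> (\<epsilon> \<otimes> a) \<otimes> \<eta>"] by (simp add: el_def skew_S_def)
    also have "\<epsilon> \<otimes> (\<Q> (\<epsilon> \<otimes> a) \<otimes> \<eta>) = (\<epsilon> \<otimes> a) \<otimes> \<epsilon> \<otimes> \<eta>"
      using a by (simp only: epsilon_nat m_closed epsilon_closed) (simp add: m_assoc)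
    also have "\<dots> = \<epsilon> \<otimes> a"
      using a by (simp add: m_assoc epsilon_eta)
    finally show "G_counit A (g \<otimes>\<^bsub>G\<^esub> h) = G_counit A (G_target A (G_counit A g) \<otimes>\<^bsub>G\<^esub> h)"
      using a by (simp add: G_target_def counit counit_el e_el del: T_mult)
  qed
qed

subsection \<open>The functor represented by \<open>\<mu>\<close>\<close>

lemma is_category_module_cat: "is_category (module_cat A)"
proof
  show "cmp (module_cat A) x y z g f \<in> mor (module_cat A) x z"
    if "x \<in> obj (module_cat A)" "y \<in> obj (module_cat A)" "z \<in> obj (module_cat A)"
      "f \<in> mor (module_cat A) x y" "g \<in> mor (module_cat A) y z" for x y z f g
    using mor_comp[OF _ _ _ that(4,5)] that(1-3) by (simp add: module_cat_def)
qed (auto simp: module_cat_def m_assoc)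

text \<open>G acts by precomposition with endomorphisms of \<mu> and arrows act by postcomposition,
  so equivariance is associativity.\<close>

lemma is_functor_hom_gset: "is_functor (module_cat A) (gset_cat G) (hom_gset_functor A)"
proof -
  interpret C: is_category "module_cat A" by (rule is_category_module_cat)
  interpret D: is_category "gset_cat G" by (rule is_category_gset_cat[OF monoid_G])
  interpret G: monoid G by (rule monoid_G)
  have comp: "g \<otimes> f \<in> mor (module_cat A) x z"
    if "x \<in> obj (module_cat A)" "y \<in> obj (module_cat A)" "z \<in> obj (module_cat A)"
      "f \<in> mor (module_cat A) x y" "g \<in> mor (module_cat A) y z" for x y z f g
    using C.cmp_closed[OF that] by (simp add: module_cat_def)
  show ?thesis
  proof
    fix x assume x: "x \<in> obj (module_cat A)"
    have "is_right_gset G (on_obj (hom_gset_functor A) x)"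
      using x mu_obj comp[of \<mu> \<mu> x]
      by unfold_locales (auto simp: hom_gset_functor_def mor_closed m_assoc G_monoid_def[of A])
    then show "on_obj (hom_gset_functor A) x \<in> obj (gset_cat G)"
      by (simp add: gset_cat_def)
    show "on_mor (hom_gset_functor A) x x (idt (module_cat A) x)
        = idt (gset_cat G) (on_obj (hom_gset_functor A) x)"
      by (auto simp: hom_gset_functor_def gset_cat_def module_cat_def restrict_def fun_eq_iff)
  next
    fix x y f
    assume "x \<in> obj (module_cat A)" "y \<in> obj (module_cat A)" "f \<in> mor (module_cat A) x y"
    then show "on_mor (hom_gset_functor A) x y f
        \<in> mor (gset_cat G) (on_obj (hom_gset_functor A) x) (on_obj (hom_gset_functor A) y)"
      using mu_obj comp[of \<mu> x y] comp[of \<mu> \<mu> x]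
      by (auto simp: hom_gset_functor_def gset_cat_def gset_hom_def mor_closed m_assoc G_monoid_def[of A])
  next
    fix x y z f g
    assume "x \<in> obj (module_cat A)" "y \<in> obj (module_cat A)" "z \<in> obj (module_cat A)"
      "f \<in> mor (module_cat A) x y" "g \<in> mor (module_cat A) y z"
    then show "on_mor (hom_gset_functor A) x z (cmp (module_cat A) x y z g f)
      = cmp (gset_cat G) (on_obj (hom_gset_functor A) x) (on_obj (hom_gset_functor A) y)
          (on_obj (hom_gset_functor A) z) (on_mor (hom_gset_functor A) y z g)
          (on_mor (hom_gset_functor A) x y f)"
    proof -
      assume xyz: "x \<in> obj (module_cat A)" "y \<in> obj (module_cat A)" "z \<in> obj (module_cat A)"
        and fg: "f \<in> mor (module_cat A) x y" "g \<in> mor (module_cat A) y z"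
      \<comment> \<open>The membership matters because the map induced by g is restricted to the
        hom-set into y and must be evaluated at \<open>f \<otimes> t\<close>.\<close>
      have "g \<otimes> f \<otimes> t = g \<otimes> (f \<otimes> t)" and "f \<otimes> t \<in> mor (module_cat A) \<mu> y"
        if "t \<in> mor (module_cat A) \<mu> x" for t
        using that fg comp[OF mu_obj xyz(1,2) that fg(1)] by (simp_all add: mor_closed m_assoc)
      moreover have "cmp (module_cat A) x y z g f = g \<otimes> f"
        by (simp add: module_cat_def)
      ultimately show ?thesis
        by (simp add: hom_gset_functor_def gset_cat_def compose_def cong: restrict_cong)
    qed
  qed
qed

lemma fully_faithful_hom_gset:
  "fully_faithful (module_cat A) (gset_cat G) (hom_gset_functor A)"
  unfolding fully_faithful_def
proof (intro ballI)
  interpret F: is_functor "module_cat A" "gset_cat G" "hom_gset_functor A"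
    by (rule is_functor_hom_gset)
  fix x y assume x: "x \<in> obj (module_cat A)" and y: "y \<in> obj (module_cat A)"
  have xA: "x \<in> carrier A" "x \<otimes> \<eta> = \<one>" "x \<otimes> \<mu> = x \<otimes> \<T> x"
    using x by (simp_all add: mem_obj)
  have x_mor: "x \<in> mor (module_cat A) \<mu> x"
    using free_mem[OF x one_closed] xA by simp
  let ?F = "on_mor (hom_gset_functor A) x y"
  let ?H = "mor (gset_cat G) (on_obj (hom_gset_functor A) x) (on_obj (hom_gset_functor A) y)"
  have F_apply: "?F f t = f \<otimes> t" if "t \<in> mor (module_cat A) \<mu> x" for f t
    using that by (simp add: hom_gset_functor_def)
  have "f = f'" if "f \<in> mor (module_cat A) x y" "f' \<in> mor (module_cat A) x y" "?F f = ?F f'" for f f'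
  proof -
    have "f \<otimes> x = f' \<otimes> x"
      using fun_cong[OF that(3), of x] by (simp add: F_apply[OF x_mor])
    \<comment> \<open>x has \<eta> as a right inverse, so it cancels.\<close>
    then have "f \<otimes> (x \<otimes> \<eta>) = f' \<otimes> (x \<otimes> \<eta>)"
      using that(1,2) xA(1) by (simp add: mor_closed flip: m_assoc)
    then show ?thesis
      using that(1,2) by (simp add: xA mor_closed)
  qed
  moreover have "\<exists>f\<in>mor (module_cat A) x y. h = ?F f" if h: "h \<in> ?H" for h
  proof -
    have h_mem: "h t \<in> mor (module_cat A) \<mu> y" if "t \<in> mor (module_cat A) \<mu> x" for t
      using h that by (auto simp: gset_cat_def gset_hom_def hom_gset_functor_def)
    have h_G: "h (t \<otimes> g) = h t \<otimes> g" if "t \<in> mor (module_cat A) \<mu> x" "g \<in> carrier G" for t g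
      using h that by (auto simp: gset_cat_def gset_hom_def hom_gset_functor_def)
    have h_ext: "h \<in> extensional (mor (module_cat A) \<mu> x)"
      using h by (auto simp: gset_cat_def gset_hom_def hom_gset_functor_def PiE_def)
    have hx: "h x \<in> carrier A"
      using h_mem[OF x_mor] by (rule mor_closed)
    \<comment> \<open>The choice is forced: if h is left multiplication by f, then
      \<open>h x \<otimes> \<eta>\<close> is \<open>f \<otimes> x \<otimes> \<eta>\<close>, which is
      f.\<close>
    define f where "f = h x \<otimes> \<eta>"
    have f: "f \<in> carrier A"
      using hx by (simp add: f_def)
    have "f \<otimes> x = h x \<otimes> \<T> x \<otimes> \<eta>"
      using hx xA(1) by (simp add: f_def m_assoc T_eta)
    also have "h x \<otimes> \<T> x = h x \<otimes> \<mu>"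
      using h_G[OF x_mor, of "\<T> x"] h_G[OF x_mor, of \<mu>] xA by simp
    finally have fx: "f \<otimes> x = h x"
      using hx by (simp add: m_assoc mu_eta)
    moreover have "h x = y \<otimes> \<T> f"
      using free_expand[OF y h_mem[OF x_mor]] by (simp add: f_def)
    ultimately have f_mor: "f \<in> mor (module_cat A) x y"
      using f by (simp add: mem_mor)
    have "h = ?F f"
    proof (rule extensionalityI[OF h_ext])
      show "?F f \<in> extensional (mor (module_cat A) \<mu> x)"
        by (simp add: hom_gset_functor_def)
      fix t assume t: "t \<in> mor (module_cat A) \<mu> x"
      then obtain a where a: "a \<in> carrier A" "t = x \<otimes> \<T> a"
        using mor_mu_eq[OF x] by auto
      \<comment> \<open>\<open>\<T> a\<close> lies in G, so equivariance determines h from its value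
        at the generator x.\<close>
      have "h t = f \<otimes> x \<otimes> \<T> a"
        using a h_G[OF x_mor, of "\<T> a"] by (simp add: fx)
      then show "h t = ?F f t"
        unfolding F_apply[OF t] using a f xA(1) by (simp add: m_assoc)
    qed
    then show ?thesis using f_mor by blast
  qed
  ultimately show "bij_betw ?F (mor (module_cat A) x y) ?H"
    using F.on_mor_closed[OF x y] unfolding bij_betw_def inj_on_def by blast
qed

end

text \<open>Acting on the right through S and T is exactly how the biset structure on the hom-sets
  is written, so the two functors coincide as records.\<close>

lemma func_comp_forget_hom_gset:
  "func_comp (bialgebroid_forget (G_source A) (G_target A)) (hom_gset_functor A) = hom_biset_functor A"
  by (simp add: func_comp_def bialgebroid_forget_def hom_gset_functor_def hom_biset_functor_def
      G_source_def G_target_def)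

theorem theorem2p2:
  fixes A :: "('a, 'x) skew_monoid_scheme"
  assumes "skew_monoidal_monoid A"
  shows "\<mu>\<^bsub>A\<^esub> \<in> obj (module_cat A) \<and>
    carrier (G_monoid A) = {\<mu>\<^bsub>A\<^esub> \<otimes>\<^bsub>A\<^esub> \<T>\<^bsub>A\<^esub> a | a. a \<in> carrier A} \<and>
    submonoid (carrier (G_monoid A)) A \<and>
    right_bialgebroid A (G_monoid A) (G_source A) (G_target A) (G_comult A) (G_counit A) \<and>
    (\<forall>x\<in>obj (module_cat A).
      mor (module_cat A) \<mu>\<^bsub>A\<^esub> x = {x \<otimes>\<^bsub>A\<^esub> \<T>\<^bsub>A\<^esub> a | a. a \<in> carrier A}) \<and>
    is_functor (module_cat A) (biset_cat A) (hom_biset_functor A) \<and>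
    is_functor (gset_cat (G_monoid A) :: (('a, 'a) gset, 'a \<Rightarrow> 'a) cat) (biset_cat A)
      (bialgebroid_forget (G_source A) (G_target A)) \<and>
    is_functor (module_cat A) (gset_cat (G_monoid A)) (hom_gset_functor A) \<and>
    fully_faithful (module_cat A) (gset_cat (G_monoid A)) (hom_gset_functor A) \<and>
    func_eq (module_cat A)
      (func_comp (bialgebroid_forget (G_source A) (G_target A)) (hom_gset_functor A))
      (hom_biset_functor A)"
proof -
  interpret skew_monoidal_monoid A by fact
  interpret right_bialgebroid A G "G_source A" "G_target A" "G_comult A" "G_counit A"
    by (rule right_bialgebroid_G)
  \<comment> \<open>Functoriality into bisets is inherited from the factorization through right
    G-sets.\<close>
  have "is_functor (module_cat A) (biset_cat A) (hom_biset_functor A)"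
    using is_functor_func_comp[OF is_functor_hom_gset is_functor_forget]
    by (simp only: func_comp_forget_hom_gset)
  then show ?thesis
    unfolding func_comp_forget_hom_gset func_eq_def
    by (intro conjI ballI refl mu_obj carrier_G submonoid_G right_bialgebroid_G mor_mu_eq
        is_functor_forget is_functor_hom_gset fully_faithful_hom_gset)
qed

end
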